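(* Let $G\leq\mathrm{Sym}(n)$ be a Frobenius group with Frobenius complement $H$ and Frobenius kernel $K$, so $G=KH$. Then $G$ has the EKR property. Furthermore, $G$ has the strict EKR property if and only if $|H|=2$.
   Context: A transitive permutation group $G\leq\mathrm{Sym}(n)$ is a Frobenius group if no non-identity element fixes more than one point and some non-identity element fixes a point. A Frobenius complement is a non-trivial proper subgroup $H$ with $H\cap g^{-1}Hg=\{\mathrm{id}\}$ for all $g\in G\setminus H$; the Frobenius kernel is $K=\left(G\setminus\bigcup_{g\in G}g^{-1}Hg\right)\cup\{\mathrm{id}\}$. Two permutations $\pi,\tau\in G$ intersect if $\pi\tau^{-1}$ has a fixed point. A subset is intersecting if every pair of its elements intersect. $G$ has the EKR property if every intersecting subset has size at most the size of the largest point-stabilizer; $G$ has the strict EKR property if moreover the only intersecting subsets of maximum size are the cosets of the point-stabilizers. *)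

theory Defs
  imports "HOL-Algebra.Sym_Groups"
begin

definition transitive_perm_group :: "nat \<Rightarrow> (nat \<Rightarrow> nat) set \<Rightarrow> bool" where
  "transitive_perm_group n G \<longleftrightarrow>
     subgroup G (sym_group n) \<and> (\<forall>x\<in>{1..n}. \<forall>y\<in>{1..n}. \<exists>g\<in>G. g x = y)"

definition fixed_points :: "nat \<Rightarrow> (nat \<Rightarrow> nat) \<Rightarrow> nat set" where
  "fixed_points n g = {x\<in>{1..n}. g x = x}"

definition frobenius_group :: "nat \<Rightarrow> (nat \<Rightarrow> nat) set \<Rightarrow> bool" where
  "frobenius_group n G \<longleftrightarrow>
     transitive_perm_group n G \<and>
     (\<forall>g\<in>G. g \<noteq> id \<longrightarrow> card (fixed_points n g) \<le> 1) \<and>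
     (\<exists>g\<in>G. g \<noteq> id \<and> fixed_points n g \<noteq> {})"

definition conj_subgroup :: "nat \<Rightarrow> (nat \<Rightarrow> nat) \<Rightarrow> (nat \<Rightarrow> nat) set \<Rightarrow> (nat \<Rightarrow> nat) set" where
  "conj_subgroup n g H = {inv\<^bsub>sym_group n\<^esub> g \<otimes>\<^bsub>sym_group n\<^esub> h \<otimes>\<^bsub>sym_group n\<^esub> g | h. h \<in> H}"

definition frobenius_complement :: "nat \<Rightarrow> (nat \<Rightarrow> nat) set \<Rightarrow> (nat \<Rightarrow> nat) set \<Rightarrow> bool" where
  "frobenius_complement n G H \<longleftrightarrow>
     subgroup H (sym_group n) \<and> H \<subseteq> G \<and> H \<noteq> {id} \<and> H \<noteq> G \<and>
     (\<forall>g\<in>G - H. H \<inter> conj_subgroup n g H = {id})"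

definition frobenius_kernel :: "nat \<Rightarrow> (nat \<Rightarrow> nat) set \<Rightarrow> (nat \<Rightarrow> nat) set \<Rightarrow> (nat \<Rightarrow> nat) set" where
  "frobenius_kernel n G H = (G - (\<Union>g\<in>G. conj_subgroup n g H)) \<union> {id}"

definition perms_intersect :: "nat \<Rightarrow> (nat \<Rightarrow> nat) \<Rightarrow> (nat \<Rightarrow> nat) \<Rightarrow> bool" where
  "perms_intersect n \<pi> \<tau> \<longleftrightarrow> fixed_points n (\<pi> \<otimes>\<^bsub>sym_group n\<^esub> inv\<^bsub>sym_group n\<^esub> \<tau>) \<noteq> {}"

definition intersecting :: "nat \<Rightarrow> (nat \<Rightarrow> nat) set \<Rightarrow> bool" where
  "intersecting n S \<longleftrightarrow> (\<forall>\<pi>\<in>S. \<forall>\<tau>\<in>S. perms_intersect n \<pi> \<tau>)"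

definition point_stabilizer :: "(nat \<Rightarrow> nat) set \<Rightarrow> nat \<Rightarrow> (nat \<Rightarrow> nat) set" where
  "point_stabilizer G x = {g\<in>G. g x = x}"

definition max_stabilizer_size :: "nat \<Rightarrow> (nat \<Rightarrow> nat) set \<Rightarrow> nat" where
  "max_stabilizer_size n G = Max ((\<lambda>x. card (point_stabilizer G x)) ` {1..n})"

definition EKR :: "nat \<Rightarrow> (nat \<Rightarrow> nat) set \<Rightarrow> bool" where
  "EKR n G \<longleftrightarrow> (\<forall>S. S \<subseteq> G \<and> intersecting n S \<longrightarrow> card S \<le> max_stabilizer_size n G)"

definition strict_EKR :: "nat \<Rightarrow> (nat \<Rightarrow> nat) set \<Rightarrow> bool" where
  "strict_EKR n G \<longleftrightarrow> EKR n G \<and>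
     (\<forall>S. S \<subseteq> G \<and> intersecting n S \<and> card S = max_stabilizer_size n G \<longrightarrow>
        (\<exists>x\<in>{1..n}. \<exists>g\<in>G. S = g <#\<^bsub>sym_group n\<^esub> point_stabilizer G x))"

end

theory Submission
  imports Defs "Jordan_Normal_Form.Spectral_Radius"
begin

text \<open>
  Let \<open>h\<close> be the order of a point stabilizer, so \<open>|G| = n h\<close>. The derangements together with the
  identity form a set \<open>K\<close> of \<open>n\<close> elements. If \<open>S\<close> is intersecting and \<open>K\<close> is a subgroup, then
  the cosets \<open>K s\<close> for \<open>s\<close> in \<open>S\<close> are disjoint, whence \<open>|S| \<le> h\<close>. That \<open>K\<close> is a subgroup is
  Frobenius' theorem.

  Frobenius' theorem is proved by characters, realised by complex matrices. Every irreducible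
  character of the stabilizer extends to a virtual character of \<open>G\<close> of norm one that is constant on
  \<open>K\<close>. A virtual character of norm one is an irreducible character up to sign, so the extension
  comes from a representation that is trivial on \<open>K\<close>, hence also on products of elements of \<open>K\<close>.
  Such a product is not conjugate to a nontrivial element of the stabilizer, because irreducible
  characters separate that element from the identity.

  For \<open>h = 2\<close>, two intersecting permutations agree at a point and so form a coset of its
  stabilizer; for \<open>h \<ge> 3\<close>, exchanging one element of a stabilizer gives a maximum
  intersecting set that is not a coset.
  Finally, an arbitrary complement has order 2 iff the point stabilizers do.
\<close>

section \<open>Rank normal form\<close>

text \<open>The character theory is set up without unitarity, complex conjugation or subspaces:
  \<open>cinner\<close> pairs \<open>f g\<close> with \<open>f' (inv g)\<close>, and rank normal
  form turns an intertwiner into triangular blocks. The only spectral input is that a complex matrix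
  has an eigenvalue, for Schur's lemma. The delicate step is to pass from "the character takes its
  degree at k" to "the representation is the identity at k". The usual reason is that the
  eigenvalues are roots of unity; here the representation is averaged over a subgroup on which the
  character is constant. Since K is not yet known to be a group, such a subgroup has to be found
  inside K, and the centralizer of a nontrivial element of K serves. The correction by the trivial
  character and its induction is what makes the extension constant on K while keeping integer
  coefficients, so that norm one leaves a single constituent. The given complement need not be
  presented as a point stabilizer. Conjugacy of complements is avoided: only the property of having
  order 2 has to pass from one malnormal subgroup to another.\<close>

definition inverse_pair :: "nat \<Rightarrow> 'a::field mat \<Rightarrow> 'a mat \<Rightarrow> bool" where
  "inverse_pair d P P' \<longleftrightarrow> P \<in> carrier_mat d d \<and> P' \<in> carrier_mat d d \<and> P * P' = 1\<^sub>m d"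

lemma inverse_pairD:
  assumes "inverse_pair d P P'"
  shows "P \<in> carrier_mat d d" "P' \<in> carrier_mat d d" "P * P' = 1\<^sub>m d" "P' * P = 1\<^sub>m d"
  using assms mat_mult_left_right_inverse[of P d P'] unfolding inverse_pair_def by auto

lemma inverse_pair_one: "inverse_pair d (1\<^sub>m d) (1\<^sub>m d)"
  unfolding inverse_pair_def by auto

lemma inverse_pair_mult:
  assumes "inverse_pair d P P'" "inverse_pair d Q Q'"
  shows "inverse_pair d (P * Q) (Q' * P')"
proof -
  have "P * Q * (Q' * P') = P * (Q * Q') * P'"
    by (smt (verit, best) assoc_mult_mat inverse_pairD(1,2) assms mult_carrier_mat)
  also have "\<dots> = 1\<^sub>m d"
    using inverse_pairD(3)[OF assms(1)] inverse_pairD(3)[OF assms(2)]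
      right_mult_one_mat[OF inverse_pairD(1)[OF assms(1)]] by simp
  finally show ?thesis
    unfolding inverse_pair_def using inverse_pairD(1,2)[OF assms(1)] inverse_pairD(1,2)[OF assms(2)] by auto
qed

lemma inverse_pair_block:
  assumes "inverse_pair d P P'"
  shows "inverse_pair (1 + d) (four_block_mat (1\<^sub>m 1) (0\<^sub>m 1 d) (0\<^sub>m d 1) P)
    (four_block_mat (1\<^sub>m 1) (0\<^sub>m 1 d) (0\<^sub>m d 1) P')"
  using inverse_pairD[OF assms] unfolding inverse_pair_def
  by (auto simp: mult_four_block_mat[of _ 1 1 _ d _ d _ _ 1 _ d])

definition partial_id :: "nat \<Rightarrow> nat \<Rightarrow> nat \<Rightarrow> 'a::field mat" where
  "partial_id d e r = mat d e (\<lambda>(i, j). if i = j \<and> i < r then 1 else 0)"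

lemma partial_id_simps [simp]:
  "dim_row (partial_id d e r) = d" "dim_col (partial_id d e r) = e"
  "partial_id d e r \<in> carrier_mat d e"
  "i < d \<Longrightarrow> j < e \<Longrightarrow> partial_id d e r $$ (i, j) = (if i = j \<and> i < r then 1 else 0)"
  unfolding partial_id_def by auto

lemma partial_id_Suc:
  "partial_id (1 + d) (1 + e) (Suc r) = four_block_mat (1\<^sub>m 1) (0\<^sub>m 1 e) (0\<^sub>m d 1) (partial_id d e r)"
  by (rule eq_matI) auto

lemma equivalent_mat_trans:
  assumes X: "(X :: 'a::field mat) \<in> carrier_mat d e"
    and 1: "inverse_pair d P P'" "inverse_pair e Q Q'"
    and 2: "inverse_pair d R R'" "inverse_pair e S S'"
    and "R * (P * X * Q) * S = Y"
  shows "inverse_pair d (R * P) (P' * R')" "inverse_pair e (Q * S) (S' * Q')"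
    "(R * P) * X * (Q * S) = Y"
proof -
  show "inverse_pair d (R * P) (P' * R')" "inverse_pair e (Q * S) (S' * Q')"
    using inverse_pair_mult[OF 2(1) 1(1)] inverse_pair_mult[OF 1(2) 2(2)] .
  note c = X inverse_pairD(1)[OF 1(1)] inverse_pairD(1)[OF 1(2)] inverse_pairD(1)[OF 2(1)] inverse_pairD(1)[OF 2(2)]
  have "R * (P * X * Q) = R * P * X * Q"
    using assoc_mult_mat[of R d d "P * X" e Q e] assoc_mult_mat[of R d d P d X e] c by simp
  then show "(R * P) * X * (Q * S) = Y"
    using assoc_mult_mat[of "R * P * X" d e Q e S e] c assms(6) by simp
qed

lemma nonzero_pivot:
  assumes X: "(X :: 'a::field mat) \<in> carrier_mat d e" and "X \<noteq> 0\<^sub>m d e"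
  obtains P P' Q Q' where "inverse_pair d P P'" "inverse_pair e Q Q'"
    "(P * X * Q) $$ (0, 0) \<noteq> 0" "e > 0"
proof -
  obtain i j where ij: "i < d" "j < e" "X $$ (i, j) \<noteq> 0"
    using assms by (metis carrier_matD eq_matI index_zero_mat)
  let ?P = "swaprows_mat d 0 i :: 'a mat" and ?Q = "swaprows_mat e 0 j :: 'a mat"
  have "?P * X = swaprows 0 i X"
    using swaprows_mat[OF X, of 0 i] ij by auto
  moreover have "swaprows 0 i X * ?Q = swapcols 0 j (swaprows 0 i X)"
    using swapcols_mat[of "swaprows 0 i X" d e 0 j] ij X by auto
  ultimately have "(?P * X * ?Q) $$ (0, 0) = X $$ (i, j)"
    using ij X by auto
  then show thesis
    using that[of ?P ?P ?Q ?Q] ij unfolding inverse_pair_def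
    by (auto simp: swaprows_mat_inv)
qed

text \<open>One step of Gaussian elimination in block form. \<open>?L\<close> scales the pivot row
  and clears the column below it, \<open>?R\<close> clears the rest of that row, and
  \<open>Z\<close> is the Schur complement of the pivot.\<close>

lemma clear_pivot:
  assumes Y: "(Y :: 'a::field mat) \<in> carrier_mat (1 + d) (1 + e)" and Y0: "Y $$ (0, 0) \<noteq> 0"
  obtains L L' R R' Z where "inverse_pair (1 + d) L L'" "inverse_pair (1 + e) R R'"
    "Z \<in> carrier_mat d e" "L * Y * R = four_block_mat (1\<^sub>m 1) (0\<^sub>m 1 e) (0\<^sub>m d 1) Z"
proof -
  define a where "a = Y $$ (0, 0)"
  have a: "a \<noteq> 0" using Y0 by (simp add: a_def)
  obtain A1 A2 A3 A4 where s: "split_block Y 1 1 = (A1, A2, A3, A4)"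
    by (metis prod_cases4)
  note sb = split_block[OF s, of d e]
  have c: "A1 \<in> carrier_mat 1 1" "A2 \<in> carrier_mat 1 e" "A3 \<in> carrier_mat d 1" "A4 \<in> carrier_mat d e"
    and Yb: "Y = four_block_mat A1 A2 A3 A4"
    using sb Y by auto
  have A1: "A1 = a \<cdot>\<^sub>m 1\<^sub>m 1"
    by (rule eq_matI) (use c in \<open>auto simp: a_def Yb\<close>)
  define B where "B = (1 / a) \<cdot>\<^sub>m A2"
  define C where "C = (1 / a) \<cdot>\<^sub>m A3"
  have c': "B \<in> carrier_mat 1 e" "C \<in> carrier_mat d 1" using c by (auto simp: B_def C_def)
  have A3: "A3 = a \<cdot>\<^sub>m C" using a c by (auto simp: C_def)
  have Y_eq: "Y = four_block_mat (a \<cdot>\<^sub>m 1\<^sub>m 1) A2 (a \<cdot>\<^sub>m C) A4"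
    using Yb A1 A3 by metis
  let ?L = "four_block_mat ((1 / a) \<cdot>\<^sub>m 1\<^sub>m 1) (0\<^sub>m 1 d) (- C) (1\<^sub>m d)"
  let ?L' = "four_block_mat (a \<cdot>\<^sub>m 1\<^sub>m 1) (0\<^sub>m 1 d) (a \<cdot>\<^sub>m C) (1\<^sub>m d)"
  let ?R = "four_block_mat (1\<^sub>m 1) (- B) (0\<^sub>m e 1) (1\<^sub>m e)"
  let ?R' = "four_block_mat (1\<^sub>m 1) B (0\<^sub>m e 1) (1\<^sub>m e)"
  have BB: "B + - B = 0\<^sub>m 1 e" using c' by (intro eq_matI) auto
  have R: "inverse_pair (1 + e) ?R ?R'"
    unfolding inverse_pair_def using c'
    by (auto simp: mult_four_block_mat[of _ 1 1 _ e _ e _ _ 1 _ e] BB[simplified] four_block_one_mat[of "Suc 0" e, simplified])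
  \<comment> \<open>The right-hand column \<open>T\<close>, \<open>U\<close> is kept general for two
    uses: zero and identity blocks show that \<open>?L'\<close> inverts \<open>?L\<close>, and
    \<open>A2\<close>, \<open>A4\<close> reduce \<open>Y\<close>.\<close>
  have LL: "four_block_mat ((1 / a) \<cdot>\<^sub>m 1\<^sub>m 1) (0\<^sub>m 1 d) (- C) (1\<^sub>m d) * four_block_mat (a \<cdot>\<^sub>m 1\<^sub>m 1) T (a \<cdot>\<^sub>m C) U
     = four_block_mat (1\<^sub>m 1) ((1 / a) \<cdot>\<^sub>m T) (0\<^sub>m d 1) (- C * T + U)"
    if "T \<in> carrier_mat 1 k" "U \<in> carrier_mat d k" for T U k
  proof -
    have 1: "(1 / a) \<cdot>\<^sub>m 1\<^sub>m 1 * (a \<cdot>\<^sub>m 1\<^sub>m 1) + 0\<^sub>m 1 d * (a \<cdot>\<^sub>m C) = 1\<^sub>m 1"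
      using a c' by (intro eq_matI) (auto simp: scalar_prod_def)
    have 2: "- C * (a \<cdot>\<^sub>m 1\<^sub>m 1) + 1\<^sub>m d * (a \<cdot>\<^sub>m C) = 0\<^sub>m d 1"
      using a c' by (intro eq_matI) (auto simp: scalar_prod_def)
    have 3: "(1 / a) \<cdot>\<^sub>m 1\<^sub>m 1 * T + 0\<^sub>m 1 d * U = (1 / a) \<cdot>\<^sub>m T"
      using that by (intro eq_matI) (auto simp: scalar_prod_def)
    have 4: "- C * T + 1\<^sub>m d * U = - C * T + U"
      using that by simp
    show ?thesis
      using that c' by (subst mult_four_block_mat[of _ 1 1 _ d _ d _ _ 1 _ k]) (auto simp only: 1 2 3 4 smult_carrier_mat one_carrier_mat zero_carrier_mat uminus_carrier_mat)
  qed
  have L: "inverse_pair (1 + d) ?L ?L'"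
    unfolding inverse_pair_def using c' LL[of "0\<^sub>m 1 d" d "1\<^sub>m d"] by auto
  define Z where "Z = - C * A2 + A4"
  have Z: "Z \<in> carrier_mat d e" using c c' by (auto simp: Z_def)
  have "?L * Y = four_block_mat (1\<^sub>m 1) B (0\<^sub>m d 1) Z"
    using LL[OF c(2) c(4)] by (simp only: B_def Z_def Y_eq)
  moreover have "- 0\<^sub>m d e + Z = Z" using Z by (intro eq_matI) auto
  ultimately have "?L * Y * ?R = four_block_mat (1\<^sub>m 1) (0\<^sub>m 1 e) (0\<^sub>m d 1) Z"
    using c' Z by (simp add: mult_four_block_mat[of _ 1 1 _ e _ d _ _ 1 _ e] uminus_l_inv_mat)
  with L R Z show thesis using that by blast
qed

text \<open>Each cleared pivot leaves a Schur complement with one row and one column fewer. The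
  result stands in for image and kernel of a linear map, with \<open>r\<close> as the rank.\<close>

lemma rank_normal_form:
  assumes "(X :: 'a::field mat) \<in> carrier_mat d e"
  obtains P P' Q Q' r where "inverse_pair d P P'" "inverse_pair e Q Q'" "r \<le> d" "r \<le> e"
    "P * X * Q = partial_id d e r"
proof -
  have "\<exists>P P' Q Q' r. inverse_pair d P P' \<and> inverse_pair e Q Q' \<and> r \<le> d \<and> r \<le> e \<and>
    P * X * Q = partial_id d e r"
    using assms
  proof (induction d arbitrary: e X)
    case (0 e X)
    have "1\<^sub>m 0 * X * 1\<^sub>m e = partial_id 0 e 0"
      using 0 by (intro eq_matI) auto
    then show ?case using inverse_pair_one by blast
  next
    case (Suc d e X)
    show ?case
    proof (cases "X = 0\<^sub>m (Suc d) e")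
      case True
      have "1\<^sub>m (Suc d) * X * 1\<^sub>m e = partial_id (Suc d) e 0"
        using True by (intro eq_matI) auto
      then show ?thesis using inverse_pair_one by blast
    next
      case False
      obtain P P' Q Q' where p: "inverse_pair (Suc d) P P'" "inverse_pair e Q Q'"
        "(P * X * Q) $$ (0, 0) \<noteq> 0" "e > 0"
        using nonzero_pivot[OF Suc.prems False] by metis
      obtain k where k: "e = 1 + k" using p(4) by (cases e) auto
      have "P * X * Q \<in> carrier_mat (1 + d) (1 + k)"
        using p Suc.prems inverse_pairD(1) k by fastforce
      from clear_pivot[OF this p(3)] obtain L L' R R' Z where l:
        "inverse_pair (1 + d) L L'" "inverse_pair (1 + k) R R'" "Z \<in> carrier_mat d k"
        "L * (P * X * Q) * R = four_block_mat (1\<^sub>m 1) (0\<^sub>m 1 k) (0\<^sub>m d 1) Z"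
        by metis
      obtain S S' T T' r where s: "inverse_pair d S S'" "inverse_pair k T T'" "r \<le> d" "r \<le> k"
        "S * Z * T = partial_id d k r"
        using Suc.IH[OF l(3)] by blast
      let ?S = "four_block_mat (1\<^sub>m 1) (0\<^sub>m 1 d) (0\<^sub>m d 1) S"
      let ?T = "four_block_mat (1\<^sub>m 1) (0\<^sub>m 1 k) (0\<^sub>m k 1) T"
      have "?S * four_block_mat (1\<^sub>m 1) (0\<^sub>m 1 k) (0\<^sub>m d 1) Z * ?T =
        four_block_mat (1\<^sub>m 1) (0\<^sub>m 1 k) (0\<^sub>m d 1) (S * Z * T)"
        using inverse_pairD(1)[OF s(1)] inverse_pairD(1)[OF s(2)] l(3)
        by (simp add: mult_four_block_mat[of _ 1 1 _ d _ d _ _ 1 _ k] mult_four_block_mat[of _ 1 1 _ k _ d _ _ 1 _ k])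
      also have "\<dots> = partial_id (1 + d) (1 + k) (Suc r)"
        unfolding s(5) partial_id_Suc ..
      finally have st: "?S * (L * (P * X * Q) * R) * ?T = partial_id (1 + d) (1 + k) (Suc r)"
        unfolding l(4) .
      have X: "X \<in> carrier_mat (1 + d) (1 + k)" using Suc.prems k by simp
      have pp: "inverse_pair (1 + d) P P'" "inverse_pair (1 + k) Q Q'" using p k by auto
      note 1 = equivalent_mat_trans[OF X pp l(1,2) refl]
      note 2 = equivalent_mat_trans[OF X 1(1,2) inverse_pair_block[OF s(1)] inverse_pair_block[OF s(2)]
        st[folded 1(3)]]
      show ?thesis unfolding k using 2 s(3,4) by (metis Suc_le_mono plus_1_eq_Suc)
    qed
  qed
  then show thesis using that by blast
qed

section \<open>Traces and idempotent matrices\<close>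

declare index_mult_mat(1) [simp del]

lemma mult_mat_index:
  assumes "A \<in> carrier_mat a b" "B \<in> carrier_mat b c" "i < a" "j < c"
  shows "(A * B) $$ (i, j) = (\<Sum>k<b. A $$ (i, k) * B $$ (k, j))"
  using assms by (subst index_mult_mat(1)) (auto simp: scalar_prod_def atLeast0LessThan)

definition mat_trace :: "'a::comm_ring_1 mat \<Rightarrow> 'a" where
  "mat_trace A = (\<Sum>i<dim_row A. A $$ (i, i))"

lemma mat_trace_comm:
  assumes "A \<in> carrier_mat d e" "B \<in> carrier_mat e d"
  shows "mat_trace (A * B) = mat_trace (B * A)"
proof -
  have "mat_trace (A * B) = (\<Sum>i<d. \<Sum>k<e. A $$ (i, k) * B $$ (k, i))"
    using assms unfolding mat_trace_def by (simp add: mult_mat_index[OF assms])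
  also have "\<dots> = (\<Sum>k<e. \<Sum>i<d. B $$ (k, i) * A $$ (i, k))"
    by (subst sum.swap) (simp add: mult.commute)
  also have "\<dots> = mat_trace (B * A)"
    using assms unfolding mat_trace_def by (simp add: mult_mat_index[OF assms(2,1)])
  finally show ?thesis .
qed

lemma mat_trace_similar:
  assumes "inverse_pair d P P'" "A \<in> carrier_mat d d"
  shows "mat_trace (P * A * P') = mat_trace A"
proof -
  note P = inverse_pairD[OF assms(1)]
  have "mat_trace (P * A * P') = mat_trace (P * (A * P'))"
    using P assms by (simp add: assoc_mult_mat[of _ d d _ d _ d])
  also have "\<dots> = mat_trace (A * P' * P)"
    by (rule mat_trace_comm) (use P assms in auto)
  also have "A * P' * P = A"
    using P assms by (simp add: assoc_mult_mat[of _ d d _ d _ d])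
  finally show ?thesis .
qed

lemma inverse_pair_cancel:
  assumes "inverse_pair d P P'" "A \<in> carrier_mat d e"
  shows "P * (P' * A) = A" "P' * (P * A) = A"
proof -
  note P = inverse_pairD[OF assms(1)]
  show "P * (P' * A) = A" "P' * (P * A) = A"
    using assoc_mult_mat[OF P(1,2) assms(2)] assoc_mult_mat[OF P(2,1) assms(2)] P assms(2) by auto
qed

lemma mult_partial_id_index:
  assumes "A \<in> carrier_mat d d'" "i < d" "j < e" "r \<le> d'"
  shows "(A * partial_id d' e r) $$ (i, j) = (if j < r then A $$ (i, j) else 0)"
proof -
  have "(A * partial_id d' e r) $$ (i, j) = (\<Sum>k<d'. if k = j then (if j < r then A $$ (i, k) else 0) else 0)"
    using assms by (subst mult_mat_index[of _ d d' _ e]) (auto simp del: sum.delta sum.delta' intro!: sum.cong)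
  then show ?thesis using assms by auto
qed

lemma partial_id_mult_index:
  assumes "B \<in> carrier_mat e' e" "i < d" "j < e" "r \<le> e'"
  shows "(partial_id d e' r * B) $$ (i, j) = (if i < r then B $$ (i, j) else 0)"
proof -
  have "(partial_id d e' r * B) $$ (i, j) = (\<Sum>k<e'. if k = i then (if i < r then B $$ (k, j) else 0) else 0)"
    using assms by (subst mult_mat_index[of _ d e' _ e]) (auto simp del: sum.delta sum.delta' intro!: sum.cong)
  then show ?thesis using assms by auto
qed

text \<open>The trace of an idempotent is its rank, taken in the field. With
  \<open>E = P' * J * Q'\<close> and \<open>M = Q' * P'\<close>, idempotency becomes
  \<open>J * M * J = J\<close>, so the leading \<open>r\<close> diagonal entries of \<open>M\<close>
  are 1 and the trace is \<open>r\<close>; characteristic 0 then gives \<open>r = 0\<close>.\<close>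

lemma idempotent_trace_zero:
  assumes E: "(E :: 'a::field_char_0 mat) \<in> carrier_mat d d" and "E * E = E" and "mat_trace E = 0"
  shows "E = 0\<^sub>m d d"
proof -
  obtain P P' Q Q' r where P: "inverse_pair d P P'" and Q: "inverse_pair d Q Q'" and r: "r \<le> d"
    and J: "P * E * Q = partial_id d d r"
    using rank_normal_form[OF E] by metis
  note p = inverse_pairD[OF P] and q = inverse_pairD[OF Q]
  define J where "J = (partial_id d d r :: 'a mat)"
  define M where "M = Q' * P'"
  have Jc: "J \<in> carrier_mat d d" by (simp add: J_def)
  have Mc: "M \<in> carrier_mat d d" using p q by (simp add: M_def)
  have assoc: "A * B * C = A * (B * C)" if "A \<in> carrier_mat d d" "B \<in> carrier_mat d d" "C \<in> carrier_mat d d"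
    for A B C :: "'a mat" by (rule assoc_mult_mat[OF that])
  have PE: "P * E = J * Q'"
  proof -
    have "J * Q' = P * E * (Q * Q')"
      unfolding J_def J[symmetric] by (rule assoc) (use p q E in auto)
    then show ?thesis using q p E by auto
  qed
  have EE: "E = P' * J * Q'"
    using inverse_pair_cancel(2)[OF P E] PE assoc[OF p(2) Jc q(2)] by simp
  have EQ: "P' * J = E * Q"
    using inverse_pair_cancel(2)[OF P, of "E * Q" d] assoc[OF p(1) E q(1)] E q J J_def by simp
  have "J * M * J = J * Q' * (P' * J)"
    unfolding M_def using p q Jc by (simp add: assoc_mult_mat[of _ d d _ d _ d])
  also have "\<dots> = P * (E * E) * Q"
    unfolding PE[symmetric] EQ using p q E by (simp add: assoc_mult_mat[of _ d d _ d _ d])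
  finally have "J * M * J = P * (E * E) * Q" .
  then have JMJ: "J * M * J = J" using J assms J_def by simp
  have Mii: "M $$ (i, i) = 1" if "i < r" for i
  proof -
    have "(J * M * J) $$ (i, i) = M $$ (i, i)"
      using that r Mc Jc unfolding J_def
      by (subst mult_partial_id_index[of _ d d]) (auto simp: partial_id_mult_index[of M d d])
    then show ?thesis using that r JMJ by (simp add: J_def)
  qed
  have "mat_trace E = mat_trace (J * M)"
    unfolding M_def EE using mat_trace_comm[of P' d d "J * Q'"] assoc p q Jc by auto
  also have "\<dots> = (\<Sum>i<d. if i < r then 1 else 0)"
    unfolding mat_trace_def J_def using Mc r Mii
    by (auto simp: partial_id_mult_index[of M d d] intro!: sum.cong)
  also have "\<dots> = (\<Sum>i\<in>{..<r}. 1)"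
    using r by (intro sum.mono_neutral_cong_right) auto
  finally have "r = 0" using assms by simp
  then have "J = 0\<^sub>m d d" by (auto simp: J_def intro!: eq_matI)
  then show ?thesis using EE p q by simp
qed

lemma sum_lessThan_add: "(\<Sum>i<r + m. f i) = (\<Sum>i<r. f i) + (\<Sum>i<m. f (r + i))" for r m :: nat
  by (induction m) (auto simp: add.assoc)

section \<open>Matrix representations and characters\<close>

definition is_rep :: "('g, 'b) monoid_scheme \<Rightarrow> nat \<Rightarrow> ('g \<Rightarrow> complex mat) \<Rightarrow> bool" where
  "is_rep G d \<rho> \<longleftrightarrow> (\<forall>g\<in>carrier G. \<rho> g \<in> carrier_mat d d) \<and> \<rho> \<one>\<^bsub>G\<^esub> = 1\<^sub>m d \<and>
     (\<forall>g\<in>carrier G. \<forall>h\<in>carrier G. \<rho> (g \<otimes>\<^bsub>G\<^esub> h) = \<rho> g * \<rho> h)"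

text \<open>The value 0 off the carrier makes characters comparable by plain equality of functions,
  and a character of a subgroup enters the induction formula already extended by zero.\<close>

definition rep_char :: "('g, 'b) monoid_scheme \<Rightarrow> ('g \<Rightarrow> complex mat) \<Rightarrow> 'g \<Rightarrow> complex" where
  "rep_char G \<rho> g = (if g \<in> carrier G then mat_trace (\<rho> g) else 0)"

definition character :: "('g, 'b) monoid_scheme \<Rightarrow> nat \<Rightarrow> ('g \<Rightarrow> complex) \<Rightarrow> bool" where
  "character G d f \<longleftrightarrow> (\<exists>\<rho>. is_rep G d \<rho> \<and> f = rep_char G \<rho>)"

text \<open>Irreducibility is a property of the character: it is not a sum of two characters of positive
  degree. This suffices for Schur's lemma, and decomposition into irreducibles becomes an induction
  on the degree that needs no complete reducibility.\<close>

definition irred :: "('g, 'b) monoid_scheme \<Rightarrow> nat \<Rightarrow> ('g \<Rightarrow> complex) \<Rightarrow> bool" where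
  "irred G d f \<longleftrightarrow> character G d f \<and> d > 0 \<and>
     \<not> (\<exists>d1 d2 f1 f2. d1 > 0 \<and> d2 > 0 \<and> d = d1 + d2 \<and> character G d1 f1 \<and> character G d2 f2 \<and> f = (\<lambda>g. f1 g + f2 g))"

lemma is_repD:
  assumes "is_rep G d \<rho>"
  shows "g \<in> carrier G \<Longrightarrow> \<rho> g \<in> carrier_mat d d" "\<rho> \<one>\<^bsub>G\<^esub> = 1\<^sub>m d"
    "g \<in> carrier G \<Longrightarrow> h \<in> carrier G \<Longrightarrow> \<rho> (g \<otimes>\<^bsub>G\<^esub> h) = \<rho> g * \<rho> h"
  using assms unfolding is_rep_def by auto

lemma character_zero: "character G 0 f \<Longrightarrow> f = (\<lambda>_. 0)"
  unfolding character_def rep_char_def by (fastforce simp: mat_trace_def fun_eq_iff dest: is_repD(1))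

lemma (in group) character_one: "character G d f \<Longrightarrow> f \<one> = of_nat d"
  unfolding character_def rep_char_def by (auto simp: is_repD mat_trace_def)

lemma rep_conj:
  assumes "is_rep G d \<rho>" "inverse_pair d P P'"
  shows "is_rep G d (\<lambda>g. P * \<rho> g * P')" "rep_char G (\<lambda>g. P * \<rho> g * P') = rep_char G \<rho>"
proof -
  note p = inverse_pairD[OF assms(2)] and r = is_repD[OF assms(1)]
  have "P * (\<rho> g * \<rho> h) * P' = P * \<rho> g * P' * (P * \<rho> h * P')" if "g \<in> carrier G" "h \<in> carrier G" for g h
  proof -
    have "P * \<rho> g * P' * (P * \<rho> h * P') = P * \<rho> g * (P' * (P * (\<rho> h * P')))"
      using p r(1)[OF that(1)] r(1)[OF that(2)] by (simp add: assoc_mult_mat[of _ d d _ d _ d])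
    also have "P' * (P * (\<rho> h * P')) = \<rho> h * P'"
      by (rule inverse_pair_cancel(2)[OF assms(2)]) (use p r(1)[OF that(2)] in auto)
    finally show ?thesis using p r(1)[OF that(1)] r(1)[OF that(2)] by (simp add: assoc_mult_mat[of _ d d _ d _ d])
  qed
  then show "is_rep G d (\<lambda>g. P * \<rho> g * P')"
    unfolding is_rep_def using p r by (auto simp: right_mult_one_mat[OF p(1)])
  show "rep_char G (\<lambda>g. P * \<rho> g * P') = rep_char G \<rho>"
    using mat_trace_similar[OF assms(2)] r by (auto simp: rep_char_def)
qed

definition upper_block :: "nat \<Rightarrow> 'a mat \<Rightarrow> 'a mat" where
  "upper_block r A = mat r r (\<lambda>ij. A $$ ij)"

definition lower_block :: "nat \<Rightarrow> nat \<Rightarrow> 'a mat \<Rightarrow> 'a mat" where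
  "lower_block r m A = mat m m (\<lambda>(i, j). A $$ (r + i, r + j))"

lemma rep_blocks:
  assumes "is_rep G (r + m) \<rho>"
    and "(\<forall>g\<in>carrier G. \<forall>i<m. \<forall>j<r. \<rho> g $$ (r + i, j) = 0) \<or> (\<forall>g\<in>carrier G. \<forall>i<r. \<forall>j<m. \<rho> g $$ (i, r + j) = 0)"
  shows "is_rep G r (\<lambda>g. upper_block r (\<rho> g))" "is_rep G m (\<lambda>g. lower_block r m (\<rho> g))"
    "rep_char G \<rho> = (\<lambda>g. rep_char G (\<lambda>g. upper_block r (\<rho> g)) g + rep_char G (\<lambda>g. lower_block r m (\<rho> g)) g)"
proof -
  note r = is_repD[OF assms(1)]
  have 1: "upper_block r (\<rho> g * \<rho> h) = upper_block r (\<rho> g) * upper_block r (\<rho> h)"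
    "lower_block r m (\<rho> g * \<rho> h) = lower_block r m (\<rho> g) * lower_block r m (\<rho> h)"
    if gh: "g \<in> carrier G" "h \<in> carrier G" for g h
  proof -
    have z1: "(\<Sum>k<m. \<rho> g $$ (i, r + k) * \<rho> h $$ (r + k, j)) = 0" if "i < r" "j < r" for i j
      using assms(2) gh that by (intro sum.neutral) auto
    have z2: "(\<Sum>k<r. \<rho> g $$ (r + i, k) * \<rho> h $$ (k, r + j)) = 0" if "i < m" "j < m" for i j
      using assms(2) gh that by (intro sum.neutral) auto
    show "upper_block r (\<rho> g * \<rho> h) = upper_block r (\<rho> g) * upper_block r (\<rho> h)"
      using z1 unfolding upper_block_def
      by (intro eq_matI) (simp_all add: mult_mat_index[OF r(1)[OF gh(1)] r(1)[OF gh(2)]]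
          mult_mat_index[of _ r r _ r] sum_lessThan_add)
    show "lower_block r m (\<rho> g * \<rho> h) = lower_block r m (\<rho> g) * lower_block r m (\<rho> h)"
      using z2 unfolding lower_block_def
      by (intro eq_matI) (simp_all add: mult_mat_index[OF r(1)[OF gh(1)] r(1)[OF gh(2)]]
          mult_mat_index[of _ m m _ m] sum_lessThan_add)
  qed
  have 2: "upper_block r (1\<^sub>m (r + m)) = (1\<^sub>m r :: complex mat)" "lower_block r m (1\<^sub>m (r + m)) = (1\<^sub>m m :: complex mat)"
    unfolding upper_block_def lower_block_def by (auto intro!: eq_matI)
  have 3: "upper_block r A \<in> carrier_mat r r" "lower_block r m A \<in> carrier_mat m m" for A :: "complex mat"
    unfolding upper_block_def lower_block_def by auto
  show "is_rep G r (\<lambda>g. upper_block r (\<rho> g))" "is_rep G m (\<lambda>g. lower_block r m (\<rho> g))"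
    unfolding is_rep_def using r 1 2 3 by auto
  show "rep_char G \<rho> = (\<lambda>g. rep_char G (\<lambda>g. upper_block r (\<rho> g)) g + rep_char G (\<lambda>g. lower_block r m (\<rho> g)) g)"
    using r(1) by (fastforce simp: rep_char_def mat_trace_def upper_block_def lower_block_def sum_lessThan_add)
qed

text \<open>In bases that bring \<open>X\<close> into rank normal form, both representations are block triangular,
  one upper and one lower, and they share the block on the image of \<open>X\<close>.\<close>

lemma intertwiner_split:
  assumes \<rho>: "is_rep G d \<rho>" and \<sigma>: "is_rep G e \<sigma>" and X: "X \<in> carrier_mat d e"
    and XX: "\<And>g. g \<in> carrier G \<Longrightarrow> \<rho> g * X = X * \<sigma> g"
  obtains r f f1 f2 where "r \<le> d" "r \<le> e" "character G r f" "character G (d - r) f1" "character G (e - r) f2"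
    "rep_char G \<rho> = (\<lambda>g. f g + f1 g)" "rep_char G \<sigma> = (\<lambda>g. f g + f2 g)"
    "r = 0 \<Longrightarrow> X = 0\<^sub>m d e" "r = d \<Longrightarrow> d = e \<Longrightarrow> \<exists>X'. inverse_pair d X X'"
proof -
  obtain P P' Q Q' r where P: "inverse_pair d P P'" and Q: "inverse_pair e Q Q'" and r: "r \<le> d" "r \<le> e"
    and J: "P * X * Q = partial_id d e r"
    using rank_normal_form[OF X] by metis
  note p = inverse_pairD[OF P] and q = inverse_pairD[OF Q] and \<rho>c = is_repD(1)[OF \<rho>] and \<sigma>c = is_repD(1)[OF \<sigma>]
  have Q': "inverse_pair e Q' Q" using q unfolding inverse_pair_def by auto
  define \<rho>1 where "\<rho>1 = (\<lambda>g. P * \<rho> g * P')"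
  define \<sigma>1 where "\<sigma>1 = (\<lambda>g. Q' * \<sigma> g * Q)"
  note r1 = rep_conj[OF \<rho> P, folded \<rho>1_def] and s1 = rep_conj[OF \<sigma> Q', folded \<sigma>1_def]
  note \<rho>1c = is_repD(1)[OF r1(1)] and \<sigma>1c = is_repD(1)[OF s1(1)]
  have eq: "\<rho>1 g * partial_id d e r = partial_id d e r * \<sigma>1 g" if g: "g \<in> carrier G" for g
  proof -
    have "\<rho>1 g * (P * X * Q) = P * \<rho> g * (P' * (P * (X * Q)))"
      unfolding \<rho>1_def using p q X \<rho>c[OF g]
      by (simp add: assoc_mult_mat[of _ d d _ d _ e] assoc_mult_mat[of _ d d _ e _ e])
    also have "P' * (P * (X * Q)) = X * Q"
      by (rule inverse_pair_cancel(2)[OF P]) (use X q in auto)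
    also have "P * \<rho> g * (X * Q) = P * ((\<rho> g * X) * Q)"
      using p q X \<rho>c[OF g]
      by (simp add: assoc_mult_mat[of _ d d _ d _ e] assoc_mult_mat[of _ d d _ e _ e])
    also have "\<dots> = P * (X * (\<sigma> g * Q))"
      using p q X \<sigma>c[OF g] XX[OF g] by (simp add: assoc_mult_mat[of _ d e _ e _ e])
    also have "\<sigma> g * Q = Q * (Q' * (\<sigma> g * Q))"
      by (rule inverse_pair_cancel(1)[OF Q, symmetric]) (use \<sigma>c[OF g] q in auto)
    also have "P * (X * (Q * (Q' * (\<sigma> g * Q)))) = P * X * Q * \<sigma>1 g"
      unfolding \<sigma>1_def using p q X \<sigma>c[OF g]
      by (simp add: assoc_mult_mat[of _ d d _ e _ e] assoc_mult_mat[of _ d e _ e _ e] assoc_mult_mat[of _ e e _ e _ e])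
    finally show ?thesis unfolding J .
  qed
  \<comment> \<open>The factor \<open>partial_id\<close> keeps the first \<open>r\<close> columns
    when on the right and the first \<open>r\<close> rows when on the left. So the lower left block
    of \<open>\<rho>1\<close> and the upper right block of \<open>\<sigma>1\<close> vanish, and the
    leading blocks agree.\<close>
  have entry: "(if j < r then \<rho>1 g $$ (i, j) else 0) = (if i < r then \<sigma>1 g $$ (i, j) else 0)"
    if "g \<in> carrier G" "i < d" "j < e" for g i j
    using eq[OF that(1)] mult_partial_id_index[OF \<rho>1c[OF that(1)] that(2,3) r(1)]
      partial_id_mult_index[OF \<sigma>1c[OF that(1)] that(2,3) r(2)]
    by simp
  obtain m k where d: "d = r + m" and e: "e = r + k" using r le_Suc_ex by metis
  have low: "\<forall>g\<in>carrier G. \<forall>i<m. \<forall>j<r. \<rho>1 g $$ (r + i, j) = 0"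
  proof (intro ballI allI impI)
    fix g i j assume "g \<in> carrier G" "i < m" "j < r"
    then show "\<rho>1 g $$ (r + i, j) = 0" using entry[of g "r + i" j] d e by auto
  qed
  have up: "\<forall>g\<in>carrier G. \<forall>i<r. \<forall>j<k. \<sigma>1 g $$ (i, r + j) = 0"
  proof (intro ballI allI impI)
    fix g i j assume "g \<in> carrier G" "i < r" "j < k"
    then show "\<sigma>1 g $$ (i, r + j) = 0" using entry[of g i "r + j"] d e by auto
  qed
  note bl1 = rep_blocks[OF r1(1)[unfolded d] disjI1[OF low]]
  note bl2 = rep_blocks[OF s1(1)[unfolded e] disjI2[OF up]]
  have same: "rep_char G (\<lambda>g. upper_block r (\<rho>1 g)) = rep_char G (\<lambda>g. upper_block r (\<sigma>1 g))"
  proof -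
    have "\<rho>1 g $$ (i, i) = \<sigma>1 g $$ (i, i)" if "g \<in> carrier G" "i < r" for g i
      using entry[of g i i] that d e by auto
    then show ?thesis by (auto simp: rep_char_def mat_trace_def upper_block_def)
  qed
  have X0: "X = 0\<^sub>m d e" if "r = 0"
  proof -
    have "P * X * Q = 0\<^sub>m d e" using J that by (auto intro!: eq_matI)
    then have "P' * (P * (X * Q)) = 0\<^sub>m d e" using p q X by (simp add: assoc_mult_mat[of _ d d _ e _ e])
    then have "X * Q = 0\<^sub>m d e" using inverse_pair_cancel(2)[OF P, of "X * Q" e] X q by simp
    then have "X * (Q * Q') = 0\<^sub>m d e"
      using assoc_mult_mat[OF X q(1,2)] q by simp
    then show ?thesis using q X by simp
  qed
  have Xinv: "\<exists>X'. inverse_pair d X X'" if "r = d" "d = e"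
  proof -
    have "P * X * Q = 1\<^sub>m d" using J that by (auto intro!: eq_matI)
    then have "P * (X * Q) = 1\<^sub>m d" using p q X that by (simp add: assoc_mult_mat[of _ d d _ d _ d])
    then have "X * Q * P = 1\<^sub>m d" using mat_mult_left_right_inverse[of P d "X * Q"] p q X that by auto
    then have "X * (Q * P) = 1\<^sub>m d" using p q X that by (simp add: assoc_mult_mat[of _ d d _ d _ d])
    then show ?thesis unfolding inverse_pair_def using p q X that by (intro exI[of _ "Q * P"]) auto
  qed
  show thesis
  proof (rule that[of r "rep_char G (\<lambda>g. upper_block r (\<rho>1 g))" "rep_char G (\<lambda>g. lower_block r m (\<rho>1 g))"
        "rep_char G (\<lambda>g. lower_block r k (\<sigma>1 g))"])
    show "rep_char G \<rho> = (\<lambda>g. rep_char G (\<lambda>g. upper_block r (\<rho>1 g)) g + rep_char G (\<lambda>g. lower_block r m (\<rho>1 g)) g)"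
      using bl1(3) r1(2) by simp
    show "rep_char G \<sigma> = (\<lambda>g. rep_char G (\<lambda>g. upper_block r (\<rho>1 g)) g + rep_char G (\<lambda>g. lower_block r k (\<sigma>1 g)) g)"
      using bl2(3) s1(2) same by simp
  qed (use r d e bl1 bl2 X0 Xinv in \<open>auto simp: character_def\<close>)
qed

text \<open>Schur's lemma on the level of characters. A nonzero \<open>X\<close> has rank
  \<open>r > 0\<close>, and irreducibility on both sides leaves no complementary block of positive
  degree, so both characters equal the shared summand.\<close>

lemma irred_intertwiner_eq:
  assumes "irred G d (rep_char G \<rho>)" "irred G e (rep_char G \<sigma>)" "is_rep G d \<rho>" "is_rep G e \<sigma>"
    and X: "X \<in> carrier_mat d e" "\<And>g. g \<in> carrier G \<Longrightarrow> \<rho> g * X = X * \<sigma> g" "X \<noteq> 0\<^sub>m d e"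
  shows "rep_char G \<rho> = rep_char G \<sigma> \<and> (d = e \<longrightarrow> (\<exists>X'. inverse_pair d X X'))"
proof -
  obtain r f f1 f2 where s: "r \<le> d" "r \<le> e" "character G r f" "character G (d - r) f1" "character G (e - r) f2"
    "rep_char G \<rho> = (\<lambda>g. f g + f1 g)" "rep_char G \<sigma> = (\<lambda>g. f g + f2 g)"
    "r = 0 \<Longrightarrow> X = 0\<^sub>m d e" "r = d \<Longrightarrow> d = e \<Longrightarrow> \<exists>X'. inverse_pair d X X'"
    using intertwiner_split[OF assms(3,4) X(1,2)] by blast
  have r: "r > 0" using s(8) X(3) by auto
  have "d - r = 0"
    using assms(1) s(1,3,4,6) r unfolding irred_def by (metis gr0I le_add_diff_inverse)
  moreover have "e - r = 0"
    using assms(2) s(2,3,5,7) r unfolding irred_def by (metis gr0I le_add_diff_inverse)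
  ultimately show ?thesis using s character_zero[of G f1] character_zero[of G f2] by auto
qed

text \<open>Subtracting an eigenvalue from \<open>X\<close> gives an intertwiner that kills an
  eigenvector; it is not invertible, hence zero.\<close>

lemma irred_schur_scalar:
  assumes "irred G d (rep_char G \<rho>)" "is_rep G d \<rho>"
    and X: "X \<in> carrier_mat d d" "\<And>g. g \<in> carrier G \<Longrightarrow> \<rho> g * X = X * \<rho> g"
  shows "\<exists>c. X = c \<cdot>\<^sub>m 1\<^sub>m d"
proof -
  have "d > 0" using assms(1) unfolding irred_def by auto
  then obtain c where "eigenvalue X c" using spectrum_non_empty[OF X(1)] unfolding spectrum_def by auto
  then obtain v where v: "v \<in> carrier_vec d" "v \<noteq> 0\<^sub>v d" "X *\<^sub>v v = c \<cdot>\<^sub>v v"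
    unfolding eigenvalue_def eigenvector_def using X(1) by auto
  define Y where "Y = X - c \<cdot>\<^sub>m 1\<^sub>m d"
  have Y: "Y \<in> carrier_mat d d" using X by (auto simp: Y_def)
  have "\<rho> g * Y = Y * \<rho> g" if g: "g \<in> carrier G" for g
    unfolding Y_def using X(1) X(2)[OF g] is_repD(1)[OF assms(2) g]
    by (simp add: mult_minus_distrib_mat[of _ d d] minus_mult_distrib_mat[of _ d d]
        mult_smult_distrib[of _ d d _ d] mult_smult_assoc_mat[of _ d d _ d])
  moreover have "\<not> inverse_pair d Y Y'" for Y'
  proof
    assume "inverse_pair d Y Y'"
    note y = inverse_pairD[OF this]
    have "Y *\<^sub>v v = X *\<^sub>v v - (c \<cdot>\<^sub>m 1\<^sub>m d) *\<^sub>v v"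
      unfolding Y_def using X v by (intro minus_mult_distrib_mat_vec) auto
    also have "\<dots> = 0\<^sub>v d" using v by auto
    finally have "Y' *\<^sub>v (Y *\<^sub>v v) = 0\<^sub>v d" using y(2) by auto
    then have "v = 0\<^sub>v d" using y v by (metis assoc_mult_mat_vec one_mult_mat_vec)
    with v show False by simp
  qed
  ultimately have "Y = 0\<^sub>m d d"
    using irred_intertwiner_eq[OF assms(1,1,2,2) Y] by blast
  then have "(X - c \<cdot>\<^sub>m 1\<^sub>m d) $$ (i, j) = 0" if "i < d" "j < d" for i j
    using that unfolding Y_def by simp
  then have "X = c \<cdot>\<^sub>m 1\<^sub>m d"
    using X(1) by (intro eq_matI) auto
  then show ?thesis by blast
qed

section \<open>Orthogonality of irreducible characters\<close>

text \<open>The usual inner product of characters, without the factor \<open>1 / |G|\<close>.\<close>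

definition cinner :: "('g, 'b) monoid_scheme \<Rightarrow> ('g \<Rightarrow> complex) \<Rightarrow> ('g \<Rightarrow> complex) \<Rightarrow> complex" where
  "cinner G f f' = (\<Sum>g\<in>carrier G. f g * f' (inv\<^bsub>G\<^esub> g))"

text \<open>The average over \<open>G\<close> of the matrix unit \<open>(i, j)\<close>, up to the factor \<open>1 / |G|\<close>.\<close>

definition avg_mat :: "('g, 'b) monoid_scheme \<Rightarrow> ('g \<Rightarrow> complex mat) \<Rightarrow> ('g \<Rightarrow> complex mat) \<Rightarrow>
    nat \<Rightarrow> nat \<Rightarrow> nat \<Rightarrow> nat \<Rightarrow> complex mat" where
  "avg_mat G \<rho> \<sigma> d e i j = mat d e (\<lambda>(a, b). \<Sum>g\<in>carrier G. \<rho> g $$ (a, i) * \<sigma> (inv\<^bsub>G\<^esub> g) $$ (j, b))"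

lemma avg_mat_carrier [simp]: "avg_mat G \<rho> \<sigma> d e i j \<in> carrier_mat d e"
  unfolding avg_mat_def by simp

lemma (in group) sum_left_translate:
  assumes "k \<in> carrier G"
  shows "(\<Sum>g\<in>carrier G. f (k \<otimes> g)) = (\<Sum>g\<in>carrier G. f g)"
  by (rule sum.reindex_bij_witness[of _ "\<lambda>g. inv k \<otimes> g" "\<lambda>g. k \<otimes> g"])
    (use assms in \<open>auto simp: m_assoc[symmetric]\<close>)

text \<open>The averaged matrix is the sum of \<open>\<rho> g * E * \<sigma> (inv g)\<close> for a
  matrix unit \<open>E\<close>, and replacing \<open>g\<close> by \<open>k \<otimes> g\<close>
  carries \<open>\<rho> k\<close> from the left to \<open>\<sigma> k\<close> on the right.\<close>

lemma (in group) avg_mat_intertwines: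
  assumes \<rho>: "is_rep G d \<rho>" and \<sigma>: "is_rep G e \<sigma>" and k: "k \<in> carrier G" and ij: "i < d" "j < e"
  shows "\<rho> k * avg_mat G \<rho> \<sigma> d e i j = avg_mat G \<rho> \<sigma> d e i j * \<sigma> k"
proof (rule eq_matI)
  note r = is_repD[OF \<rho>] and s = is_repD[OF \<sigma>]
  fix a b assume "a < dim_row (avg_mat G \<rho> \<sigma> d e i j * \<sigma> k)" "b < dim_col (avg_mat G \<rho> \<sigma> d e i j * \<sigma> k)"
  then have ab: "a < d" "b < e" using s(1)[OF k] by (auto simp: avg_mat_def)
  have "(\<rho> k * avg_mat G \<rho> \<sigma> d e i j) $$ (a, b) =
      (\<Sum>c<d. \<rho> k $$ (a, c) * (\<Sum>g\<in>carrier G. \<rho> g $$ (c, i) * \<sigma> (inv g) $$ (j, b)))"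
    using ab by (simp add: mult_mat_index[OF r(1)[OF k] avg_mat_carrier]) (simp add: avg_mat_def)
  also have "\<dots> = (\<Sum>g\<in>carrier G. (\<Sum>c<d. \<rho> k $$ (a, c) * \<rho> g $$ (c, i)) * \<sigma> (inv g) $$ (j, b))"
    unfolding sum_distrib_left sum_distrib_right by (subst sum.swap) (simp add: mult.assoc)
  \<comment> \<open>Writing \<open>inv g\<close> as \<open>inv (k \<otimes> g) \<otimes> k\<close>
    makes the summand a function of \<open>k \<otimes> g\<close> alone, ready for
    translation.\<close>
  also have "\<dots> = (\<Sum>g\<in>carrier G. \<rho> (k \<otimes> g) $$ (a, i) * \<sigma> (inv (k \<otimes> g) \<otimes> k) $$ (j, b))"
  proof (rule sum.cong)
    fix g assume g: "g \<in> carrier G"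
    have "inv (k \<otimes> g) \<otimes> k = inv g" using g k by (simp add: inv_mult_group m_assoc)
    then show "(\<Sum>c<d. \<rho> k $$ (a, c) * \<rho> g $$ (c, i)) * \<sigma> (inv g) $$ (j, b) =
      \<rho> (k \<otimes> g) $$ (a, i) * \<sigma> (inv (k \<otimes> g) \<otimes> k) $$ (j, b)"
      using r(3)[OF k g] mult_mat_index[OF r(1)[OF k] r(1)[OF g] ab(1) ij(1)] by simp
  qed simp
  also have "\<dots> = (\<Sum>g\<in>carrier G. \<rho> g $$ (a, i) * \<sigma> (inv g \<otimes> k) $$ (j, b))"
    by (rule sum_left_translate[OF k])
  also have "\<dots> = (\<Sum>g\<in>carrier G. \<rho> g $$ (a, i) * (\<Sum>c<e. \<sigma> (inv g) $$ (j, c) * \<sigma> k $$ (c, b)))"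
  proof (rule sum.cong)
    fix g assume g: "g \<in> carrier G"
    have "\<sigma> (inv g \<otimes> k) $$ (j, b) = (\<Sum>c<e. \<sigma> (inv g) $$ (j, c) * \<sigma> k $$ (c, b))"
      using s(3)[OF inv_closed[OF g] k] mult_mat_index[OF s(1)[OF inv_closed[OF g]] s(1)[OF k] ij(2) ab(2)] by simp
    then show "\<rho> g $$ (a, i) * \<sigma> (inv g \<otimes> k) $$ (j, b) =
      \<rho> g $$ (a, i) * (\<Sum>c<e. \<sigma> (inv g) $$ (j, c) * \<sigma> k $$ (c, b))" by simp
  qed simp
  also have "\<dots> = (\<Sum>c<e. (\<Sum>g\<in>carrier G. \<rho> g $$ (a, i) * \<sigma> (inv g) $$ (j, c)) * \<sigma> k $$ (c, b))"
    unfolding sum_distrib_left sum_distrib_right by (subst sum.swap) (simp add: mult.assoc)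
  also have "\<dots> = (avg_mat G \<rho> \<sigma> d e i j * \<sigma> k) $$ (a, b)"
    using ab by (simp add: mult_mat_index[OF avg_mat_carrier s(1)[OF k]]) (simp add: avg_mat_def)
  finally show "(\<rho> k * avg_mat G \<rho> \<sigma> d e i j) $$ (a, b) = (avg_mat G \<rho> \<sigma> d e i j * \<sigma> k) $$ (a, b)" .
qed (use is_repD(1)[OF \<rho> k] is_repD(1)[OF \<sigma> k] in \<open>auto simp: avg_mat_def\<close>)

text \<open>A product of two traces is a double sum of products of diagonal entries, and
  \<open>\<rho> g $$ (i, i) * \<sigma> (inv g) $$ (j, j)\<close> is what \<open>g\<close>
  contributes to the entry \<open>(i, j)\<close> of the averaged unit \<open>(i, j)\<close>.\<close>

lemma (in group) cinner_avg_mat: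
  assumes \<rho>: "is_rep G d \<rho>" and \<sigma>: "is_rep G e \<sigma>"
  shows "cinner G (rep_char G \<rho>) (rep_char G \<sigma>) = (\<Sum>i<d. \<Sum>j<e. avg_mat G \<rho> \<sigma> d e i j $$ (i, j))"
proof -
  note r = is_repD[OF \<rho>] and s = is_repD[OF \<sigma>]
  have "cinner G (rep_char G \<rho>) (rep_char G \<sigma>) =
      (\<Sum>g\<in>carrier G. (\<Sum>i<d. \<rho> g $$ (i, i)) * (\<Sum>j<e. \<sigma> (inv g) $$ (j, j)))"
    unfolding cinner_def rep_char_def mat_trace_def
  proof (rule sum.cong)
    fix g assume g: "g \<in> carrier G"
    show "(if g \<in> carrier G then \<Sum>i<dim_row (\<rho> g). \<rho> g $$ (i, i) else 0) *
         (if inv g \<in> carrier G then \<Sum>i<dim_row (\<sigma> (inv g)). \<sigma> (inv g) $$ (i, i) else 0) =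
         (\<Sum>i<d. \<rho> g $$ (i, i)) * (\<Sum>j<e. \<sigma> (inv g) $$ (j, j))"
      using g r(1)[OF g] s(1)[OF inv_closed[OF g]] by simp
  qed simp
  also have "\<dots> = (\<Sum>i<d. \<Sum>j<e. \<Sum>g\<in>carrier G. \<rho> g $$ (i, i) * \<sigma> (inv g) $$ (j, j))"
    unfolding sum_product by (subst sum.swap, rule sum.cong, simp, rule sum.swap)
  also have "\<dots> = (\<Sum>i<d. \<Sum>j<e. avg_mat G \<rho> \<sigma> d e i j $$ (i, j))"
    by (simp add: avg_mat_def)
  finally show ?thesis .
qed

lemma (in group) irred_cinner_diff:
  assumes "irred G d f" "irred G e f'" "f \<noteq> f'"
  shows "cinner G f f' = 0"
proof -
  obtain \<rho> \<sigma> where \<rho>: "is_rep G d \<rho>" "f = rep_char G \<rho>" and \<sigma>: "is_rep G e \<sigma>" "f' = rep_char G \<sigma>"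
    using assms(1,2) unfolding irred_def character_def by blast
  have "avg_mat G \<rho> \<sigma> d e i j = 0\<^sub>m d e" if "i < d" "j < e" for i j
    using irred_intertwiner_eq[OF assms(1,2)[unfolded \<rho>(2) \<sigma>(2)] \<rho>(1) \<sigma>(1) avg_mat_carrier
        avg_mat_intertwines[OF \<rho>(1) \<sigma>(1) _ that]] assms(3) \<rho>(2) \<sigma>(2) by blast
  then show ?thesis unfolding \<rho>(2) \<sigma>(2) cinner_avg_mat[OF \<rho>(1) \<sigma>(1)] by simp
qed

text \<open>Each averaged unit is a scalar matrix by Schur's lemma, and its trace determines the
  scalar: it is the sum over the group of the entry \<open>(j, i)\<close> of
  \<open>\<rho> (inv g) * \<rho> g\<close>, an identity matrix. Only the \<open>d\<close> units with
  \<open>i = j\<close> survive, each contributing \<open>?N / d\<close>.\<close>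

lemma (in group) irred_cinner_same:
  assumes "irred G d f"
  shows "cinner G f f = of_nat (card (carrier G))"
proof -
  obtain \<rho> where \<rho>: "is_rep G d \<rho>" "f = rep_char G \<rho>"
    using assms unfolding irred_def character_def by blast
  note r = is_repD[OF \<rho>(1)]
  let ?A = "avg_mat G \<rho> \<rho> d d" and ?N = "of_nat (card (carrier G)) :: complex"
  have d: "d > 0" using assms unfolding irred_def by simp
  have A: "?A i j $$ (i, j) = (if i = j then ?N / of_nat d else 0)" if ij: "i < d" "j < d" for i j
  proof -
    obtain c where c: "?A i j = c \<cdot>\<^sub>m 1\<^sub>m d"
      using irred_schur_scalar[OF assms[unfolded \<rho>(2)] \<rho>(1) avg_mat_carrier
          avg_mat_intertwines[OF \<rho>(1) \<rho>(1) _ ij]] by blast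
    have "of_nat d * c = (\<Sum>a<d. ?A i j $$ (a, a))" unfolding c by simp
    also have "\<dots> = (\<Sum>g\<in>carrier G. \<Sum>a<d. \<rho> (inv g) $$ (j, a) * \<rho> g $$ (a, i))"
      unfolding avg_mat_def by (subst sum.swap) (simp add: mult.commute)
    also have "\<dots> = (\<Sum>g\<in>carrier G. if i = j then 1 else 0)"
    proof (rule sum.cong)
      fix g assume g: "g \<in> carrier G"
      have "(\<Sum>a<d. \<rho> (inv g) $$ (j, a) * \<rho> g $$ (a, i)) = (\<rho> (inv g) * \<rho> g) $$ (j, i)"
        using mult_mat_index[OF r(1)[OF inv_closed[OF g]] r(1)[OF g] ij(2,1)] by simp
      also have "\<dots> = (if i = j then 1 else 0)"
      proof -
        have "\<rho> (inv g) * \<rho> g = 1\<^sub>m d"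
          using r(3)[OF inv_closed[OF g] g] r(2) l_inv[OF g] by metis
        then show ?thesis using ij by simp
      qed
      finally show "(\<Sum>a<d. \<rho> (inv g) $$ (j, a) * \<rho> g $$ (a, i)) = (if i = j then 1 else 0)" .
    qed simp
    finally have "c = (if i = j then ?N / of_nat d else 0)" using d by (auto simp: field_simps)
    then show ?thesis unfolding c using ij by simp
  qed
  have "cinner G f f = (\<Sum>i<d. \<Sum>j<d. if i = j then ?N / of_nat d else 0)"
    unfolding \<rho>(2) cinner_avg_mat[OF \<rho>(1) \<rho>(1)] using A by simp
  then show ?thesis using d by simp
qed

section \<open>Decomposition into irreducibles and virtual characters\<close>

lemma character_decompose:
  assumes "character G d f"
  shows "\<exists>M. (\<forall>x\<in>#M. \<exists>e. irred G e x) \<and> f = (\<lambda>g. \<Sum>x\<in>#M. x g)"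
  using assms
proof (induction d arbitrary: f rule: less_induct)
  case (less d f)
  consider "d = 0" | "irred G d f" | d1 d2 f1 f2 where "d1 < d" "d2 < d" "character G d1 f1" "character G d2 f2"
    "f = (\<lambda>g. f1 g + f2 g)"
  proof (cases "d = 0 \<or> irred G d f")
    case False
    then obtain d1 d2 f1 f2 where *: "d1 > 0" "d2 > 0" "d = d1 + d2" "character G d1 f1" "character G d2 f2"
      "f = (\<lambda>g. f1 g + f2 g)"
      using less.prems unfolding irred_def by auto
    show thesis by (rule that(3)[OF _ _ *(4-6)]) (use *(1-3) in simp_all)
  next
    case True
    then show thesis by (rule disjE) (erule that(1), erule that(2))
  qed
  then show ?case
  proof cases
    case 1
    have "f = (\<lambda>_. 0)" by (rule character_zero[of G]) (use 1 less.prems in simp)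
    then show ?thesis by (intro exI[of _ "{#}"]) auto
  next
    case 2
    then show ?thesis by (intro exI[of _ "{#f#}"]) auto
  next
    case 3
    obtain M1 M2 where "\<forall>x\<in>#M1. \<exists>e. irred G e x" "f1 = (\<lambda>g. \<Sum>x\<in>#M1. x g)"
       "\<forall>x\<in>#M2. \<exists>e. irred G e x" "f2 = (\<lambda>g. \<Sum>x\<in>#M2. x g)"
      using less.IH[OF 3(1,3)] less.IH[OF 3(2,4)] by blast
    then show ?thesis using 3(5) by (intro exI[of _ "M1 + M2"]) auto
  qed
qed

lemma cinner_sum_mset:
  "cinner G (\<lambda>g. \<Sum>x\<in>#M. x g) f = (\<Sum>x\<in>#M. cinner G x f)"
  "cinner G f (\<lambda>g. \<Sum>x\<in>#M. x g) = (\<Sum>x\<in>#M. cinner G f x)"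
  by (induction M) (auto simp: cinner_def sum.distrib algebra_simps)

lemma sum_mset_of_nat_mult: "(\<Sum>x\<in>#M. c * of_nat (f x)) = (c :: 'a::comm_semiring_1) * of_nat (\<Sum>x\<in>#M. f x)"
  by (induction M) (simp_all add: distrib_left)

lemma sum_mset_zero: "(\<forall>x\<in>#M. f x = 0) \<Longrightarrow> (\<Sum>x\<in>#M. f x) = (0 :: 'a::comm_monoid_add)"
  by (induction M) auto

text \<open>After cancelling common constituents the two multisets are disjoint, so the mixed inner
  products vanish and the norm is the group order times a sum of squared multiplicities. Total 1
  leaves one constituent, on one of the two sides.\<close>

lemma (in group) virtual_character_norm_one:
  assumes AB: "\<forall>x\<in>#A. \<exists>e. irred G e x" "\<forall>x\<in>#B. \<exists>e. irred G e x"
    and f: "f = (\<lambda>g. (\<Sum>x\<in>#A. x g) - (\<Sum>x\<in>#B. x g))"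
    and norm: "cinner G f f = of_nat (card (carrier G))" and fin: "finite (carrier G)"
  obtains d x where "irred G d x" "f = x \<or> f = (\<lambda>g. - x g)"
proof -
  let ?S = "\<lambda>M g. \<Sum>x\<in>#M. x (g :: 'a) :: complex"
  define A' where "A' = A - B"
  define B' where "B' = B - A"
  have irr: "\<forall>x\<in>#A'. \<exists>e. irred G e x" "\<forall>x\<in>#B'. \<exists>e. irred G e x"
    using AB unfolding A'_def B'_def by (auto dest: in_diffD)
  define C where "C = A \<inter># B"
  have A: "A = A' + C" and B: "B = B' + C"
    unfolding A'_def B'_def C_def by (auto simp: multiset_eq_iff)
  have "?S A g = ?S A' g + ?S C g" "?S B g = ?S B' g + ?S C g" for g
    by (subst A, simp) (subst B, simp)
  then have f': "f = (\<lambda>g. ?S A' g - ?S B' g)" unfolding f by auto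
  have disj: "x \<noteq> y" if "x \<in># A'" "y \<in># B'" for x y
    using that unfolding A'_def B'_def in_diff_count by (metis less_asym)
  have 0: "cinner G (?S A') (?S B') = 0" "cinner G (?S B') (?S A') = 0"
  proof -
    have "cinner G x y = 0 \<and> cinner G y x = 0" if xy: "x \<in># A'" "y \<in># B'" for x y
    proof -
      obtain d where "irred G d x" using irr(1) xy(1) by blast
      moreover obtain e where "irred G e y" using irr(2) xy(2) by blast
      ultimately show ?thesis using irred_cinner_diff[of d x e y] irred_cinner_diff[of e y d x] disj[OF xy] by simp
    qed
    then show "cinner G (?S A') (?S B') = 0" "cinner G (?S B') (?S A') = 0"
      unfolding cinner_sum_mset by (intro sum_mset_zero ballI; simp)+
  qed
  let ?N = "of_nat (card (carrier G)) :: complex"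
  \<comment> \<open>Summing \<open>count M x\<close> over the members of \<open>M\<close>, with
    repetition, is the sum of the squares of the multiplicities.\<close>
  have sq: "cinner G (?S M) (?S M) = ?N * of_nat (\<Sum>x\<in>#M. count M x)"
    if M: "\<forall>x\<in>#M. \<exists>e. irred G e x" for M
  proof -
    have *: "(\<Sum>y\<in>#L. cinner G x y) = ?N * of_nat (count L x)" if "x \<in># M" "L \<subseteq># M" for x L
      using that(2)
    proof (induction L)
      case (add y L)
      have "x \<in># M" "y \<in># M" using that add.prems by (auto dest: mset_subset_eqD)
      then have "cinner G x y = (if x = y then ?N else 0)"
      proof -
        obtain d e where "irred G d x" "irred G e y" using M \<open>x \<in># M\<close> \<open>y \<in># M\<close> by blast
        then show ?thesis using irred_cinner_diff[of d x e y] irred_cinner_same[of d x] by (cases "x = y") auto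
      qed
      moreover have "L \<subseteq># M" using add.prems by (meson mset_subset_eq_insertD subset_mset.less_imp_le)
      ultimately show ?case using add.IH by (auto simp: algebra_simps)
    qed simp
    have "cinner G (?S M) (?S M) = (\<Sum>x\<in>#M. \<Sum>y\<in>#M. cinner G x y)"
      unfolding cinner_sum_mset ..
    also have "\<dots> = (\<Sum>x\<in>#M. ?N * of_nat (count M x))"
      using * by (intro arg_cong[of _ _ sum_mset] image_mset_cong) auto
    also have "\<dots> = ?N * of_nat (\<Sum>x\<in>#M. count M x)"
      by (rule sum_mset_of_nat_mult)
    finally show ?thesis .
  qed
  have size: "size M \<le> (\<Sum>x\<in>#M. count M x)" for M :: "('a \<Rightarrow> complex) multiset"
  proof -
    have "(\<Sum>x\<in>#M. 1) \<le> (\<Sum>x\<in>#M. count M x)"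
      by (rule sum_mset_mono) (simp add: Suc_le_eq)
    then show ?thesis by (simp only: size_eq_sum_mset)
  qed
  let ?a = "\<Sum>x\<in>#A'. count A' x" and ?b = "\<Sum>x\<in>#B'. count B' x"
  have "cinner G f f = cinner G (?S A') (?S A') - cinner G (?S A') (?S B') - cinner G (?S B') (?S A') + cinner G (?S B') (?S B')"
    unfolding f' cinner_def by (simp add: algebra_simps sum.distrib sum_subtractf)
  also have "\<dots> = ?N * of_nat (?a + ?b)"
    unfolding 0 sq[OF irr(1)] sq[OF irr(2)] by (simp add: algebra_simps)
  finally have "?N * of_nat (?a + ?b) = ?N * of_nat 1" using norm by simp
  moreover have "?N \<noteq> 0" using fin by auto
  ultimately have ab: "?a + ?b = 1" by (metis mult_cancel_left of_nat_eq_iff)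
  consider "size A' = 1" "size B' = 0" | "size A' = 0" "size B' = 1"
  proof -
    have "size A' + size B' \<le> 1" using size[of A'] size[of B'] ab by linarith
    moreover have "\<not> (size A' = 0 \<and> size B' = 0)" using ab by auto
    ultimately have "size A' = 1 \<and> size B' = 0 \<or> size A' = 0 \<and> size B' = 1" by linarith
    then show thesis using that by argo
  qed
  then show thesis
  proof cases
    case 1
    then obtain x where x: "A' = {#x#}" "B' = {#}"
      using size_1_singleton_mset size_eq_0_iff_empty by blast
    obtain e where "irred G e x" using irr unfolding x by auto
    moreover have "f = (\<lambda>g. x g)" unfolding f' x by simp
    ultimately show thesis using that by blast
  next
    case 2
    then obtain x where x: "B' = {#x#}" "A' = {#}"
      using size_1_singleton_mset size_eq_0_iff_empty by blast
    obtain e where "irred G e x" using irr unfolding x by auto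
    moreover have "f = (\<lambda>g. - x g)" unfolding f' x by simp
    ultimately show thesis using that by blast
  qed
qed

text \<open>"Kernel" means a family of matrix coefficients indexed by an arbitrary finite set, not a
  normal subgroup. A bijection with an initial segment of the naturals turns it into matrices, so
  the regular and the induced representation can use group elements and pairs as indices.\<close>

lemma character_of_kernel:
  assumes I: "finite I"
    and mult: "\<And>g h i k. g \<in> carrier G \<Longrightarrow> h \<in> carrier G \<Longrightarrow> i \<in> I \<Longrightarrow> k \<in> I \<Longrightarrow>
      M (g \<otimes>\<^bsub>G\<^esub> h) i k = (\<Sum>j\<in>I. M g i j * M h j k)"
    and one: "\<And>i j. i \<in> I \<Longrightarrow> j \<in> I \<Longrightarrow> M \<one>\<^bsub>G\<^esub> i j = (if i = j then 1 else 0)"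
  shows "character G (card I) (\<lambda>g. if g \<in> carrier G then \<Sum>i\<in>I. M g i i else 0)"
proof -
  obtain \<phi> where \<phi>: "bij_betw \<phi> {..<card I} I"
    using ex_bij_betw_nat_finite[OF I] by (metis atLeast0LessThan)
  then have \<phi>I: "\<phi> i \<in> I" if "i < card I" for i using that by (auto dest: bij_betwE)
  have inj: "\<phi> i = \<phi> j \<longleftrightarrow> i = j" if "i < card I" "j < card I" for i j
    using \<phi> that by (auto simp: bij_betw_def inj_on_def)
  define \<rho> where "\<rho> g = mat (card I) (card I) (\<lambda>(i, j). M g (\<phi> i) (\<phi> j))" for g
  have c: "\<rho> g \<in> carrier_mat (card I) (card I)" for g by (simp add: \<rho>_def)
  have "is_rep G (card I) \<rho>"
    unfolding is_rep_def
  proof (intro conjI ballI)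
    show "\<rho> \<one>\<^bsub>G\<^esub> = 1\<^sub>m (card I)"
      unfolding \<rho>_def using one \<phi>I inj by (intro eq_matI) auto
    show "\<rho> (g \<otimes>\<^bsub>G\<^esub> h) = \<rho> g * \<rho> h" if "g \<in> carrier G" "h \<in> carrier G" for g h
    proof (rule eq_matI)
      fix i k assume "i < dim_row (\<rho> g * \<rho> h)" "k < dim_col (\<rho> g * \<rho> h)"
      then have ik: "i < card I" "k < card I" by (auto simp: \<rho>_def)
      have "(\<rho> g * \<rho> h) $$ (i, k) = (\<Sum>j<card I. M g (\<phi> i) (\<phi> j) * M h (\<phi> j) (\<phi> k))"
        using ik by (subst mult_mat_index[OF c c]) (auto simp: \<rho>_def)
      also have "\<dots> = (\<Sum>j\<in>I. M g (\<phi> i) j * M h j (\<phi> k))"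
        by (rule sum.reindex_bij_betw[OF \<phi>])
      finally show "\<rho> (g \<otimes>\<^bsub>G\<^esub> h) $$ (i, k) = (\<rho> g * \<rho> h) $$ (i, k)"
        using mult[OF that \<phi>I \<phi>I] ik by (simp add: \<rho>_def)
    qed (auto simp: \<rho>_def)
  qed (rule c)
  moreover have "rep_char G \<rho> = (\<lambda>g. if g \<in> carrier G then \<Sum>i\<in>I. M g i i else 0)"
  proof
    fix g
    have "mat_trace (\<rho> g) = (\<Sum>i\<in>I. M g i i)"
      using sum.reindex_bij_betw[OF \<phi>, of "\<lambda>i. M g i i"] by (simp add: mat_trace_def \<rho>_def)
    then show "rep_char G \<rho> g = (if g \<in> carrier G then \<Sum>i\<in>I. M g i i else 0)"
      by (simp add: rep_char_def)
  qed
  ultimately show ?thesis unfolding character_def by metis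
qed

text \<open>Left translation as permutation matrices: a diagonal entry at \<open>x\<close> requires
  \<open>x = g \<otimes> x\<close>, which only the identity satisfies.\<close>

lemma (in group) regular_character:
  assumes "finite (carrier G)"
  shows "character G (card (carrier G)) (\<lambda>g. if g = \<one> then of_nat (card (carrier G)) else 0)"
proof -
  let ?M = "\<lambda>g x y. if x = g \<otimes> y then 1 else 0 :: complex"
  have "character G (card (carrier G)) (\<lambda>g. if g \<in> carrier G then \<Sum>i\<in>carrier G. ?M g i i else 0)"
  proof (rule character_of_kernel[where M = ?M, OF assms])
    fix g h x z assume *: "g \<in> carrier G" "h \<in> carrier G" "x \<in> carrier G" "z \<in> carrier G"
    have "(\<Sum>y\<in>carrier G. ?M g x y * ?M h y z) = (\<Sum>y\<in>carrier G. if y = h \<otimes> z then ?M g x y else 0)"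
      by (rule sum.cong) auto
    also have "\<dots> = ?M g x (h \<otimes> z)" using * assms by (subst sum.delta) auto
    finally show "?M (g \<otimes> h) x z = (\<Sum>y\<in>carrier G. ?M g x y * ?M h y z)"
      using * by (simp add: m_assoc)
  qed auto
  moreover have "(\<lambda>g. if g \<in> carrier G then \<Sum>i\<in>carrier G. ?M g i i else 0) =
    (\<lambda>g. if g = \<one> then of_nat (card (carrier G)) else 0)"
  proof
    fix g
    have "g \<otimes> x \<noteq> x" if "g \<in> carrier G" "g \<noteq> \<one>" "x \<in> carrier G" for x
      using that by simp
    then have "(\<Sum>i\<in>carrier G. ?M g i i) = (if g = \<one> then of_nat (card (carrier G)) else 0)" if "g \<in> carrier G"
      using that by (cases "g = \<one>") (auto intro!: sum.neutral)
    then show "(if g \<in> carrier G then \<Sum>i\<in>carrier G. ?M g i i else 0) =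
      (if g = \<one> then of_nat (card (carrier G)) else 0)" by auto
  qed
  ultimately show ?thesis by metis
qed

text \<open>If every irreducible character took its degree at \<open>h\<close>, the regular
  character would agree at \<open>h\<close> and at the identity, but it is 0 at the one and the
  group order at the other.\<close>

lemma (in group) irred_separates:
  assumes "finite (carrier G)" "h \<in> carrier G" "h \<noteq> \<one>"
  obtains d f where "irred G d f" "f h \<noteq> of_nat d"
proof (rule ccontr)
  assume "\<not> thesis"
  with that have no: "\<not> (irred G d f \<and> f h \<noteq> of_nat d)" for d f by blast
  have *: "f h = f \<one>" if f: "irred G d f" for d f
  proof -
    have "character G d f" using f unfolding irred_def by simp
    then show ?thesis using no[of d f] f character_one by simp
  qed
  obtain M where M: "\<forall>x\<in>#M. \<exists>e. irred G e x"
    "(\<lambda>g. if g = \<one> then of_nat (card (carrier G)) else 0) = (\<lambda>g. \<Sum>x\<in>#M. x g)"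
    using character_decompose[OF regular_character[OF assms(1)]] by metis
  have "(\<Sum>x\<in>#M. x h) = (\<Sum>x\<in>#M. x \<one>)"
    using M(1) * by (intro arg_cong[of _ _ sum_mset] image_mset_cong) blast
  moreover have "(\<Sum>x\<in>#M. x h) = 0"
    using fun_cong[OF M(2), of h] assms(3) by simp
  moreover have "(\<Sum>x\<in>#M. x \<one>) = of_nat (card (carrier G))"
    using fun_cong[OF M(2), of \<one>] by simp
  ultimately have "of_nat (card (carrier G)) = (0 :: complex)" by argo
  then show False using assms by (auto simp: card_eq_0_iff)
qed

text \<open>The average \<open>P\<close> of all \<open>\<rho> g\<close> is an idempotent of trace
  \<open>d\<close>. Its complement is an idempotent of trace 0 and so vanishes; \<open>P\<close> is
  the identity, and it absorbs every \<open>\<rho> k\<close>.\<close>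

lemma (in group) constant_trace_rep_trivial:
  assumes fin: "finite (carrier G)" and \<rho>: "is_rep G d \<rho>"
    and tr: "\<And>g. g \<in> carrier G \<Longrightarrow> mat_trace (\<rho> g) = of_nat d" and k: "k \<in> carrier G"
  shows "\<rho> k = 1\<^sub>m d"
proof -
  note r = is_repD[OF \<rho>]
  let ?N = "of_nat (card (carrier G)) :: complex"
  have N: "?N \<noteq> 0" using fin by auto
  define P where "P = mat d d (\<lambda>(a, b). (\<Sum>g\<in>carrier G. \<rho> g $$ (a, b)) / ?N)"
  have P: "P \<in> carrier_mat d d" by (simp add: P_def)
  have translate: "\<rho> h * P = P" if h: "h \<in> carrier G" for h
  proof (rule eq_matI)
    fix a b assume "a < dim_row P" "b < dim_col P"
    then have ab: "a < d" "b < d" by (auto simp: P_def)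
    have "(\<rho> h * P) $$ (a, b) = (\<Sum>c<d. \<rho> h $$ (a, c) * ((\<Sum>g\<in>carrier G. \<rho> g $$ (c, b)) / ?N))"
      using ab by (simp add: mult_mat_index[OF r(1)[OF h] P]) (simp add: P_def)
    also have "\<dots> = (\<Sum>g\<in>carrier G. \<Sum>c<d. \<rho> h $$ (a, c) * \<rho> g $$ (c, b)) / ?N"
      by (subst sum.swap) (simp add: sum_distrib_left sum_divide_distrib)
    also have "\<dots> = (\<Sum>g\<in>carrier G. \<rho> (h \<otimes> g) $$ (a, b)) / ?N"
      using r(3)[OF h] mult_mat_index[OF r(1)[OF h] r(1) ab] by simp
    also have "\<dots> = (\<Sum>g\<in>carrier G. \<rho> g $$ (a, b)) / ?N"
      using sum_left_translate[OF h, of "\<lambda>g. \<rho> g $$ (a, b)"] by simp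
    finally show "(\<rho> h * P) $$ (a, b) = P $$ (a, b)" using ab by (simp add: P_def)
  qed (use r(1)[OF h] in \<open>auto simp: P_def\<close>)
  have PP: "P * P = P"
  proof (rule eq_matI)
    fix a b assume "a < dim_row P" "b < dim_col P"
    then have ab: "a < d" "b < d" by (auto simp: P_def)
    have "(P * P) $$ (a, b) = (\<Sum>c<d. (\<Sum>g\<in>carrier G. \<rho> g $$ (a, c)) / ?N * P $$ (c, b))"
      unfolding mult_mat_index[OF P P ab] using ab by (simp add: P_def)
    also have "\<dots> = (\<Sum>g\<in>carrier G. \<Sum>c<d. \<rho> g $$ (a, c) * P $$ (c, b)) / ?N"
      by (subst sum.swap) (simp add: sum_distrib_right sum_divide_distrib)
    also have "\<dots> = (\<Sum>g\<in>carrier G. P $$ (a, b)) / ?N"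
      using mult_mat_index[OF r(1) P ab] translate by simp
    finally show "(P * P) $$ (a, b) = P $$ (a, b)" using N by simp
  qed (auto simp: P_def)
  have "mat_trace P = (\<Sum>g\<in>carrier G. mat_trace (\<rho> g)) / ?N"
  proof -
    have "(\<Sum>g\<in>carrier G. mat_trace (\<rho> g)) = (\<Sum>g\<in>carrier G. \<Sum>i<d. \<rho> g $$ (i, i))"
      using r(1) by (intro sum.cong) (auto simp: mat_trace_def)
    also have "\<dots> = (\<Sum>i<d. \<Sum>g\<in>carrier G. \<rho> g $$ (i, i))" by (rule sum.swap)
    finally show ?thesis by (simp add: mat_trace_def P_def sum_divide_distrib)
  qed
  then have trP: "mat_trace P = of_nat d" using tr N by simp
  let ?E = "1\<^sub>m d - P"
  have E: "?E \<in> carrier_mat d d" using P by auto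
  have "P * ?E = 0\<^sub>m d d"
    using mult_minus_distrib_mat[OF P one_carrier_mat P] PP P by simp
  then have "?E * ?E = 1\<^sub>m d * ?E - 0\<^sub>m d d"
    using minus_mult_distrib_mat[OF one_carrier_mat P E] by simp
  also have "\<dots> = ?E" unfolding left_mult_one_mat[OF E] using P by (intro eq_matI) auto
  finally have "?E * ?E = ?E" .
  moreover have "mat_trace ?E = 0"
    using trP P unfolding mat_trace_def by (simp add: sum_subtractf)
  ultimately have E0: "?E = 0\<^sub>m d d" using idempotent_trace_zero[OF E] by simp
  have "P = 1\<^sub>m d"
  proof (rule eq_matI)
    fix i j assume "i < dim_row (1\<^sub>m d :: complex mat)" "j < dim_col (1\<^sub>m d :: complex mat)"
    then have ij: "i < d" "j < d" by auto
    have "?E $$ (i, j) = 0" using E0 ij by simp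
    then show "P $$ (i, j) = 1\<^sub>m d $$ (i, j)" using ij P by simp
  qed (use P in auto)
  then show ?thesis using translate[OF k] r(1)[OF k] by simp
qed

lemma rep_restrict:
  assumes "is_rep G d \<rho>" "subgroup H G"
  shows "is_rep (G\<lparr>carrier := H\<rparr>) d \<rho>"
  using assms subgroup.subset[OF assms(2)] unfolding is_rep_def by auto

lemma trivial_character: "character G 1 (\<lambda>g. if g \<in> carrier G then 1 else 0)"
  using character_of_kernel[of "{0::nat}" G "\<lambda>g i j. 1"] by (simp cong: if_cong)

lemma sum_mset_repeat: "(\<Sum>x\<in>#repeat_mset d M. f x) = of_nat d * (\<Sum>x\<in>#M. f x :: 'a::comm_semiring_1)"
  by (induction d) (simp_all add: distrib_right sum_mset.distrib)

section \<open>Frobenius' theorem\<close>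

text \<open>The common abstraction of point stabilizers and Frobenius complements, free of any
  action. Both become instances, so that their orders can be compared.\<close>

locale malnormal = group G + subgroup H G for G (structure) and H +
  assumes finite_carrier: "finite (carrier G)"
    and malnormal: "\<lbrakk>g \<in> carrier G; h \<in> H; h \<noteq> \<one>; g \<otimes> h \<otimes> inv g \<in> H\<rbrakk> \<Longrightarrow> g \<in> H"
begin

text \<open>The predicate under \<open>SOME\<close> depends only on the left coset of
  \<open>g\<close>, hence so does the choice; the image of the whole carrier therefore has one
  element in each left coset.\<close>

definition coset_rep :: "'a \<Rightarrow> 'a" where
  "coset_rep g = (SOME x. x \<in> carrier G \<and> inv g \<otimes> x \<in> H)"

definition transversal :: "'a set" where
  "transversal = coset_rep ` carrier G"

abbreviation GH where "GH \<equiv> G\<lparr>carrier := H\<rparr>"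

lemma group_GH: "group GH"
  using subgroup_is_group is_group subgroup_axioms subgroup.subgroup_is_group by blast

lemma coset_rep:
  assumes "g \<in> carrier G"
  shows "coset_rep g \<in> carrier G" "inv g \<otimes> coset_rep g \<in> H"
proof -
  have "\<exists>x. x \<in> carrier G \<and> inv g \<otimes> x \<in> H" using assms by (intro exI[of _ g]) auto
  from someI_ex[OF this] show "coset_rep g \<in> carrier G" "inv g \<otimes> coset_rep g \<in> H"
    unfolding coset_rep_def by auto
qed

lemma coset_trans:
  assumes "g \<in> carrier G" "h \<in> carrier G" "k \<in> carrier G" "inv g \<otimes> h \<in> H" "inv h \<otimes> k \<in> H"
  shows "inv g \<otimes> k \<in> H"
proof -
  have "inv g \<otimes> h \<otimes> (inv h \<otimes> k) = inv g \<otimes> k"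
  proof -
    have "h \<otimes> (inv h \<otimes> k) = k" using assms by (simp add: m_assoc[symmetric])
    then show ?thesis using assms by (simp add: m_assoc)
  qed
  then show ?thesis using assms m_closed by metis
qed

lemma coset_sym:
  assumes "g \<in> carrier G" "h \<in> carrier G" "inv g \<otimes> h \<in> H"
  shows "inv h \<otimes> g \<in> H"
  using m_inv_closed[OF assms(3)] assms by (simp add: inv_mult_group)

lemma transversal_ex1:
  assumes "g \<in> carrier G"
  shows "\<exists>!t. t \<in> transversal \<and> inv t \<otimes> g \<in> H"
proof (rule ex1I[of _ "coset_rep g"])
  show "coset_rep g \<in> transversal \<and> inv (coset_rep g) \<otimes> g \<in> H"
    using coset_rep[OF assms] coset_sym assms unfolding transversal_def by auto
  fix t assume t: "t \<in> transversal \<and> inv t \<otimes> g \<in> H"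
  then obtain a where a: "a \<in> carrier G" "t = coset_rep a" unfolding transversal_def by auto
  note ta = coset_rep[OF a(1), folded a(2)]
  have ag: "inv a \<otimes> g \<in> H" using coset_trans[OF a(1) ta(1) assms ta(2)] t by simp
  have "(x \<in> carrier G \<and> inv a \<otimes> x \<in> H) = (x \<in> carrier G \<and> inv g \<otimes> x \<in> H)" for x
    using coset_trans[OF a(1) assms _ ag] coset_trans[OF assms a(1) _ coset_sym[OF a(1) assms ag]] by blast
  then show "t = coset_rep g" unfolding a(2) coset_rep_def by simp
qed

lemma transversal_carrier: "t \<in> transversal \<Longrightarrow> t \<in> carrier G"
  using coset_rep unfolding transversal_def by auto

lemma transversal_eqI:
  assumes "s \<in> transversal" "t \<in> transversal" "inv s \<otimes> t \<in> H"
  shows "s = t"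
  using transversal_ex1[OF transversal_carrier[OF assms(2)]] assms transversal_carrier[OF assms(2)] by auto

lemma finite_transversal: "finite transversal"
  unfolding transversal_def using finite_carrier by simp

lemma card_transversal: "card transversal * card H = card (carrier G)"
proof -
  have "(\<Sum>t\<in>transversal. if inv t \<otimes> g \<in> H then 1 else 0) = (1::nat)" if g: "g \<in> carrier G" for g
  proof -
    obtain t where t: "t \<in> transversal" "inv t \<otimes> g \<in> H" "\<And>s. s \<in> transversal \<Longrightarrow> inv s \<otimes> g \<in> H \<Longrightarrow> s = t"
      using transversal_ex1[OF g] by blast
    then have eq: "inv s \<otimes> g \<in> H \<longleftrightarrow> s = t" if "s \<in> transversal" for s using that by blast
    have "(\<Sum>s\<in>transversal. if inv s \<otimes> g \<in> H then 1 else 0) = (\<Sum>s\<in>transversal. if s = t then 1 else (0::nat))"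
      by (rule sum.cong[OF refl]) (simp only: eq)
    then show ?thesis using t(1) finite_transversal by simp
  qed
  then have "card (carrier G) = (\<Sum>g\<in>carrier G. \<Sum>t\<in>transversal. if inv t \<otimes> g \<in> H then 1 else 0)"
    by simp
  also have "\<dots> = (\<Sum>t\<in>transversal. \<Sum>g\<in>carrier G. if inv t \<otimes> g \<in> H then 1 else 0)"
    by (rule sum.swap)
  also have "\<dots> = (\<Sum>t\<in>transversal. \<Sum>g\<in>carrier G. if g \<in> H then 1 else 0)"
    by (rule sum.cong[OF refl], rule sum_left_translate) (simp add: transversal_carrier)
  also have "(\<Sum>g\<in>carrier G. if g \<in> H then 1 else 0) = card H"
    using finite_carrier subset by (simp add: sum.If_cases Int_absorb1)
  finally show ?thesis by simp
qed

section \<open>Induced characters and the extension of irreducibles\<close>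

lemma conj_mult_insert:
  assumes "t \<in> carrier G" "s \<in> carrier G" "r \<in> carrier G" "g \<in> carrier G" "h \<in> carrier G"
  shows "inv t \<otimes> (g \<otimes> h) \<otimes> r = (inv t \<otimes> g \<otimes> s) \<otimes> (inv s \<otimes> h \<otimes> r)"
proof -
  have "s \<otimes> (inv s \<otimes> (h \<otimes> r)) = h \<otimes> r" using assms by (simp add: m_assoc[symmetric])
  then show ?thesis using assms by (simp add: m_assoc)
qed

text \<open>The matrices consist of blocks indexed by the transversal; the block at
  \<open>(t, s)\<close> is the representation at \<open>inv t \<otimes> g \<otimes> s\<close>, or
  zero outside \<open>H\<close>. Each block column has just one nonzero block, so the sum in a
  product collapses to one term.\<close>

lemma induced_character:
  assumes "character GH d f"
  shows "character G (card transversal * d) (\<lambda>g. if g \<in> carrier G then \<Sum>t\<in>transversal. f (inv t \<otimes> g \<otimes> t) else 0)"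
proof -
  obtain \<rho> where \<rho>: "is_rep GH d \<rho>" "f = rep_char GH \<rho>" using assms unfolding character_def by auto
  note r = is_repD[OF \<rho>(1), simplified]
  define N where "N u i j = (if u \<in> H then \<rho> u $$ (i, j) else 0)" for u i j
  \<comment> \<open>Extension by zero stays multiplicative as long as the right factor lies in
    \<open>H\<close>: then \<open>u\<close> and \<open>u \<otimes> v\<close> are both in
    \<open>H\<close> or both outside.\<close>
  have N_mult: "N (u \<otimes> v) i k = (\<Sum>j<d. N u i j * N v j k)"
    if "u \<in> carrier G" "v \<in> H" "i < d" "k < d" for u v i k
  proof (cases "u \<in> H")
    case True
    then show ?thesis using that r mult_mat_index[OF r(1)[OF True] r(1)[OF that(2)] that(3,4)]
      by (simp add: N_def)
  next
    case False
    have "u \<otimes> v \<notin> H"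
    proof
      assume "u \<otimes> v \<in> H"
      then have "u \<otimes> v \<otimes> inv v \<in> H" using that m_inv_closed m_closed by metis
      then show False using False that by (simp add: m_assoc)
    qed
    then show ?thesis using False by (simp add: N_def)
  qed
  let ?I = "transversal \<times> {..<d}"
  let ?M = "\<lambda>g (t, i) (s, j). N (inv t \<otimes> g \<otimes> s) i j"
  have "character G (card ?I) (\<lambda>g. if g \<in> carrier G then \<Sum>i\<in>?I. ?M g i i else 0)"
  proof (rule character_of_kernel[where M = ?M])
    fix g h p q assume gh: "g \<in> carrier G" "h \<in> carrier G" and "p \<in> ?I" "q \<in> ?I"
    then obtain t i u k where p: "p = (t, i)" "t \<in> transversal" "i < d" and q: "q = (u, k)" "u \<in> transversal" "k < d"
      by auto
    note tc = transversal_carrier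
    obtain s where s: "s \<in> transversal" "inv s \<otimes> (h \<otimes> u) \<in> H"
       "\<And>x. x \<in> transversal \<Longrightarrow> inv x \<otimes> (h \<otimes> u) \<in> H \<Longrightarrow> x = s"
      using transversal_ex1[of "h \<otimes> u"] gh tc[OF q(2)] by blast
    have z: "N (inv x \<otimes> h \<otimes> u) j k = 0" if "x \<in> transversal" "x \<noteq> s" for x j
      using s(3)[OF that(1)] that(2) gh tc[OF that(1)] tc[OF q(2)] by (auto simp: N_def m_assoc)
    have "(\<Sum>l\<in>?I. ?M g p l * ?M h l q) = (\<Sum>x\<in>transversal. \<Sum>j<d. N (inv t \<otimes> g \<otimes> x) i j * N (inv x \<otimes> h \<otimes> u) j k)"
      by (simp add: p(1) q(1) sum.cartesian_product case_prod_beta)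
    also have "\<dots> = (\<Sum>x\<in>transversal. if x = s then \<Sum>j<d. N (inv t \<otimes> g \<otimes> x) i j * N (inv x \<otimes> h \<otimes> u) j k else 0)"
      using z by (intro sum.cong) auto
    also have "\<dots> = (\<Sum>j<d. N (inv t \<otimes> g \<otimes> s) i j * N (inv s \<otimes> h \<otimes> u) j k)"
      using s(1) finite_transversal by simp
    also have "\<dots> = N (inv t \<otimes> g \<otimes> s \<otimes> (inv s \<otimes> h \<otimes> u)) i k"
    proof (rule N_mult[OF _ _ p(3) q(3), symmetric])
      show "inv s \<otimes> h \<otimes> u \<in> H" using s(2) gh tc[OF q(2)] tc[OF s(1)] by (simp add: m_assoc)
    qed (use gh tc[OF p(2)] tc[OF s(1)] in simp)
    also have "inv t \<otimes> g \<otimes> s \<otimes> (inv s \<otimes> h \<otimes> u) = inv t \<otimes> (g \<otimes> h) \<otimes> u"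
      using conj_mult_insert[OF tc[OF p(2)] tc[OF s(1)] tc[OF q(2)] gh] by simp
    finally show "?M (g \<otimes> h) p q = (\<Sum>l\<in>?I. ?M g p l * ?M h l q)" by (simp add: p(1) q(1))
  next
    fix p q assume "p \<in> ?I" "q \<in> ?I"
    then obtain t i u k where p: "p = (t, i)" "t \<in> transversal" "i < d" and q: "q = (u, k)" "u \<in> transversal" "k < d"
      by auto
    have "inv t \<otimes> \<one> \<otimes> u = inv t \<otimes> u" using transversal_carrier p q by simp
    then show "?M \<one> p q = (if p = q then 1 else 0)"
      using p q transversal_eqI[OF p(2) q(2)] transversal_carrier r(2) by (auto simp: N_def)
  qed (use finite_transversal in auto)
  moreover have sumI: "(\<Sum>i\<in>?I. ?M g i i) = (\<Sum>t\<in>transversal. f (inv t \<otimes> g \<otimes> t))" for g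
  proof -
    have "(\<Sum>i<d. N u i i) = f u" for u
      using r(1)[of u] by (auto simp: N_def \<rho>(2) rep_char_def mat_trace_def)
    moreover have "(\<Sum>i\<in>?I. ?M g i i) = (\<Sum>t\<in>transversal. \<Sum>i<d. N (inv t \<otimes> g \<otimes> t) i i)"
      unfolding sum.cartesian_product by (rule sum.cong) auto
    ultimately show ?thesis by simp
  qed
  ultimately show ?thesis unfolding sumI card_cartesian_product card_lessThan by blast
qed

text \<open>For a character \<open>f\<close> of \<open>H\<close> of degree \<open>d\<close>, this is the virtual character
  \<open>Ind f - d Ind 1 + d 1\<close>: it takes the values of \<open>f\<close> on the conjugates of \<open>H\<close> and the value \<open>d\<close>
  elsewhere.\<close>

definition char_ext :: "nat \<Rightarrow> ('a \<Rightarrow> complex) \<Rightarrow> 'a \<Rightarrow> complex" where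
  "char_ext d f g = (if g \<in> carrier G then of_nat d + (\<Sum>t\<in>transversal.
     if inv t \<otimes> g \<otimes> t \<in> H then f (inv t \<otimes> g \<otimes> t) - of_nat d else 0) else 0)"

text \<open>The element \<open>inv s \<otimes> t\<close> conjugates one nontrivial element of
  \<open>H\<close> to another, so malnormality puts it in \<open>H\<close>, and \<open>s\<close>,
  \<open>t\<close> represent the same coset.\<close>

lemma transversal_conj_unique:
  assumes "g \<in> carrier G" "g \<noteq> \<one>" "s \<in> transversal" "t \<in> transversal"
    and "inv s \<otimes> g \<otimes> s \<in> H" "inv t \<otimes> g \<otimes> t \<in> H"
  shows "s = t"
proof -
  note c = transversal_carrier[OF assms(3)] transversal_carrier[OF assms(4)]
  let ?k = "inv s \<otimes> t" and ?x = "inv t \<otimes> g \<otimes> t"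
  have 1: "?k \<otimes> ?x \<otimes> inv ?k = inv s \<otimes> g \<otimes> s"
  proof -
    have "t \<otimes> (inv t \<otimes> (g \<otimes> (t \<otimes> (inv t \<otimes> s)))) = g \<otimes> s"
      using c assms(1) by (simp add: m_assoc[symmetric])
    then show ?thesis using c assms(1) by (simp add: m_assoc inv_mult_group)
  qed
  have "?x \<noteq> \<one>"
  proof
    assume "?x = \<one>"
    then have "t \<otimes> ?x \<otimes> inv t = \<one>" using c by simp
    moreover have "t \<otimes> ?x \<otimes> inv t = g" using c assms(1) by (simp add: m_assoc[symmetric]) (simp add: m_assoc)
    ultimately show False using assms(2) by simp
  qed
  then have "?k \<in> H" using malnormal[of ?k ?x] assms 1 c by simp
  then show ?thesis using transversal_eqI assms by simp
qed

lemma char_ext_in_conj: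
  assumes "g \<in> carrier G" "g \<noteq> \<one>" "t \<in> transversal" "inv t \<otimes> g \<otimes> t \<in> H"
  shows "char_ext d f g = f (inv t \<otimes> g \<otimes> t)"
proof -
  have "(\<Sum>s\<in>transversal. if inv s \<otimes> g \<otimes> s \<in> H then f (inv s \<otimes> g \<otimes> s) - of_nat d else 0) =
    (\<Sum>s\<in>transversal. if s = t then f (inv t \<otimes> g \<otimes> t) - of_nat d else 0)"
  proof (rule sum.cong[OF refl])
    fix s assume "s \<in> transversal"
    then have "inv s \<otimes> g \<otimes> s \<in> H \<longleftrightarrow> s = t"
      using transversal_conj_unique[OF assms(1,2) _ assms(3) _ assms(4)] assms(4) by blast
    then show "(if inv s \<otimes> g \<otimes> s \<in> H then f (inv s \<otimes> g \<otimes> s) - of_nat d else 0) =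
      (if s = t then f (inv t \<otimes> g \<otimes> t) - of_nat d else 0)" by (cases "s = t") simp_all
  qed
  then show ?thesis unfolding char_ext_def using assms finite_transversal by simp
qed

lemma char_ext_not_in_conj:
  assumes "g \<in> carrier G" "\<And>t. t \<in> transversal \<Longrightarrow> inv t \<otimes> g \<otimes> t \<notin> H"
  shows "char_ext d f g = of_nat d"
  unfolding char_ext_def using assms by simp

lemma char_ext_one:
  assumes "character GH d f"
  shows "char_ext d f \<one> = of_nat d"
proof -
  have "f \<one> = of_nat d" using group.character_one[OF group_GH assms] by simp
  then show ?thesis unfolding char_ext_def using transversal_carrier by (auto intro!: sum.neutral)
qed

lemma inv_conj:
  assumes "g \<in> carrier G" "t \<in> carrier G"
  shows "inv t \<otimes> inv g \<otimes> t = inv (inv t \<otimes> g \<otimes> t)"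
  using assms by (simp add: inv_mult_group m_assoc)

lemma sum_conj:
  assumes "t \<in> carrier G"
  shows "(\<Sum>g\<in>carrier G. f (inv t \<otimes> g \<otimes> t)) = (\<Sum>g\<in>carrier G. f g)"
proof (rule sum.reindex_bij_witness[of _ "\<lambda>g. t \<otimes> g \<otimes> inv t" "\<lambda>g. inv t \<otimes> g \<otimes> t"])
  fix a assume a: "a \<in> carrier G"
  show "t \<otimes> (inv t \<otimes> a \<otimes> t) \<otimes> inv t = a" using a assms by (simp add: m_assoc[symmetric]) (simp add: m_assoc)
  show "inv t \<otimes> (t \<otimes> a \<otimes> inv t) \<otimes> t = a" using a assms by (simp add: m_assoc[symmetric]) (simp add: m_assoc)
qed (use assms in auto)

text \<open>The product at \<open>g\<close> is \<open>d * d\<close> plus deviations on the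
  conjugates of \<open>H\<close>. Every member of the transversal contributes
  \<open>card H * (1 - d * d)\<close> in total, because \<open>f\<close> has norm
  \<open>card H\<close>; multiplied by the index, this leaves exactly the group order.\<close>

lemma char_ext_norm:
  assumes irr: "irred GH d f"
  shows "cinner G (char_ext d f) (char_ext d f) = of_nat (card (carrier G))"
proof -
  have ch: "character GH d f" using irr unfolding irred_def by simp
  have f1: "f \<one> = of_nat d" using group.character_one[OF group_GH ch] by simp
  let ?d = "of_nat d :: complex"
  \<comment> \<open>The deviation from \<open>d * d\<close>. It is 0 at the identity, the only
    element shared by different conjugates of \<open>H\<close>, so nothing is counted twice.\<close>
  define v where "v x = (if x \<in> H then f x * f (inv x) - ?d * ?d else 0)" for x
  have pt: "char_ext d f g * char_ext d f (inv g) = ?d * ?d + (\<Sum>t\<in>transversal. v (inv t \<otimes> g \<otimes> t))"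
    if g: "g \<in> carrier G" for g
  proof (cases "g = \<one>")
    case True
    have "v (inv t \<otimes> \<one> \<otimes> t) = 0" if "t \<in> transversal" for t
      using transversal_carrier[OF that] f1 by (simp add: v_def)
    then show ?thesis using True char_ext_one[OF ch] by simp
  next
    case g1: False
    note ic = inv_conj[OF g transversal_carrier]
    show ?thesis
    proof (cases "\<exists>t\<in>transversal. inv t \<otimes> g \<otimes> t \<in> H")
      case True
      then obtain t where t: "t \<in> transversal" "inv t \<otimes> g \<otimes> t \<in> H" by auto
      have ti: "inv t \<otimes> inv g \<otimes> t \<in> H" using ic[OF t(1)] m_inv_closed[OF t(2)] by simp
      have "inv g \<noteq> \<one>" using g g1 by (metis inv_inv inv_one)
      then have "char_ext d f (inv g) = f (inv (inv t \<otimes> g \<otimes> t))"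
        using char_ext_in_conj[OF inv_closed[OF g] _ t(1) ti] ic[OF t(1)] by simp
      moreover have "char_ext d f g = f (inv t \<otimes> g \<otimes> t)" by (rule char_ext_in_conj[OF g g1 t])
      moreover have "(\<Sum>s\<in>transversal. v (inv s \<otimes> g \<otimes> s)) = (\<Sum>s\<in>transversal. if s = t then v (inv t \<otimes> g \<otimes> t) else 0)"
      proof (rule sum.cong[OF refl])
        fix s assume "s \<in> transversal"
        then have "inv s \<otimes> g \<otimes> s \<in> H \<longleftrightarrow> s = t"
          using transversal_conj_unique[OF g g1 _ t(1) _ t(2)] t(2) by blast
        then show "v (inv s \<otimes> g \<otimes> s) = (if s = t then v (inv t \<otimes> g \<otimes> t) else 0)"
          by (cases "s = t") (simp_all add: v_def)
      qed
      ultimately show ?thesis using t finite_transversal by (simp add: v_def)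
    next
      case False
      have "inv t \<otimes> inv g \<otimes> t \<notin> H" if "t \<in> transversal" for t
      proof
        assume "inv t \<otimes> inv g \<otimes> t \<in> H"
        then have "inv (inv (inv t \<otimes> g \<otimes> t)) \<in> H" using ic[OF that] m_inv_closed by metis
        then show False using False that g transversal_carrier[OF that] by auto
      qed
      then have "char_ext d f g = ?d" "char_ext d f (inv g) = ?d"
        using char_ext_not_in_conj g False by auto
      then show ?thesis using False by (simp add: v_def)
    qed
  qed
  have vsum: "(\<Sum>g\<in>carrier G. v g) = of_nat (card H) * (1 - ?d * ?d)"
  proof -
    have "(\<Sum>g\<in>carrier G. v g) = (\<Sum>g\<in>H. f g * f (inv g) - ?d * ?d)"
      using finite_carrier subset by (intro sum.mono_neutral_cong_right) (auto simp: v_def)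
    also have "\<dots> = (\<Sum>g\<in>H. f g * f (inv g)) - of_nat (card H) * (?d * ?d)"
      by (simp add: sum_subtractf)
    also have "(\<Sum>g\<in>H. f g * f (inv g)) = cinner GH f f"
      unfolding cinner_def using m_inv_consistent[OF subgroup_axioms] by simp
    also have "\<dots> = of_nat (card H)"
      using group.irred_cinner_same[OF group_GH irr] by simp
    finally show ?thesis by (simp add: algebra_simps)
  qed
  have "cinner G (char_ext d f) (char_ext d f) =
      (\<Sum>g\<in>carrier G. ?d * ?d + (\<Sum>t\<in>transversal. v (inv t \<otimes> g \<otimes> t)))"
    unfolding cinner_def using pt by (rule sum.cong[OF refl])
  also have "\<dots> = of_nat (card (carrier G)) * (?d * ?d) + (\<Sum>t\<in>transversal. \<Sum>g\<in>carrier G. v (inv t \<otimes> g \<otimes> t))"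
    by (subst sum.swap) (simp add: sum.distrib)
  also have "(\<Sum>t\<in>transversal. \<Sum>g\<in>carrier G. v (inv t \<otimes> g \<otimes> t)) =
      (\<Sum>t\<in>transversal. of_nat (card H) * (1 - ?d * ?d))"
    using sum_conj[OF transversal_carrier, of _ v] vsum by (intro sum.cong) auto
  also have "\<dots> = of_nat (card (carrier G)) * (1 - ?d * ?d)"
    unfolding card_transversal[symmetric] by simp
  finally show ?thesis by (simp add: algebra_simps)
qed

text \<open>\<open>A\<close>, \<open>B\<close>, \<open>C\<close> hold the constituents of the
  induced \<open>f\<close>, the trivial character and the induced trivial character. The value
  \<open>d > 0\<close> at the identity excludes the negative sign left open by the norm, and fixes
  the degree.\<close>

lemma char_ext_irred:
  assumes irr: "irred GH d f"
  shows "irred G d (char_ext d f)"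
proof -
  have ch: "character GH d f" and d: "d > 0" using irr unfolding irred_def by auto
  let ?ind = "\<lambda>f g. if g \<in> carrier G then \<Sum>t\<in>transversal. f (inv t \<otimes> g \<otimes> t) else 0"
  let ?one = "\<lambda>g. if g \<in> carrier GH then 1 else 0 :: complex"
  obtain A where A: "\<forall>x\<in>#A. \<exists>e. irred G e x" "?ind f = (\<lambda>g. \<Sum>x\<in>#A. x g)"
    using character_decompose[OF induced_character[OF ch]] by blast
  obtain B where B: "\<forall>x\<in>#B. \<exists>e. irred G e x" "(\<lambda>g. if g \<in> carrier G then 1 else 0) = (\<lambda>g. \<Sum>x\<in>#B. x g)"
    using character_decompose[OF trivial_character] by blast
  obtain C where C: "\<forall>x\<in>#C. \<exists>e. irred G e x" "?ind ?one = (\<lambda>g. \<Sum>x\<in>#C. x g)"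
    using character_decompose[OF induced_character[OF trivial_character]] by blast
  have f0: "f x = 0" if "x \<notin> H" for x
    using ch that unfolding character_def rep_char_def by auto
  have eq: "char_ext d f = (\<lambda>g. (\<Sum>x\<in>#A + repeat_mset d B. x g) - (\<Sum>x\<in>#repeat_mset d C. x g))"
  proof
    fix g
    have "(\<Sum>x\<in>#A + repeat_mset d B. x g) - (\<Sum>x\<in>#repeat_mset d C. x g) =
        ?ind f g + of_nat d * (if g \<in> carrier G then 1 else 0) - of_nat d * ?ind ?one g"
      using fun_cong[OF A(2), of g] fun_cong[OF B(2), of g] fun_cong[OF C(2), of g]
      by (simp only: image_mset_union sum_mset.union sum_mset_repeat)
    also have "\<dots> = char_ext d f g"
    proof (cases "g \<in> carrier G")
      case True
      have "(\<Sum>t\<in>transversal. if inv t \<otimes> g \<otimes> t \<in> H then f (inv t \<otimes> g \<otimes> t) - of_nat d else 0) =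
        (\<Sum>t\<in>transversal. f (inv t \<otimes> g \<otimes> t) - of_nat d * ?one (inv t \<otimes> g \<otimes> t))"
        using f0 by (intro sum.cong) auto
      also have "\<dots> = ?ind f g - of_nat d * ?ind ?one g"
        using True by (simp only: sum_subtractf sum_distrib_left if_True)
      finally show ?thesis using True unfolding char_ext_def by simp
    next
      case False
      then show ?thesis by (simp add: char_ext_def)
    qed
    finally show "char_ext d f g = (\<Sum>x\<in>#A + repeat_mset d B. x g) - (\<Sum>x\<in>#repeat_mset d C. x g)" ..
  qed
  have AB: "\<forall>x\<in>#A + repeat_mset d B. \<exists>e. irred G e x" "\<forall>x\<in>#repeat_mset d C. \<exists>e. irred G e x"
  proof -
    have "x \<in># M" if "x \<in># repeat_mset d M" for x and M :: "('a \<Rightarrow> complex) multiset"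
      using that by (metis count_eq_zero_iff count_repeat_mset mult_0_right)
    then show "\<forall>x\<in>#A + repeat_mset d B. \<exists>e. irred G e x" "\<forall>x\<in>#repeat_mset d C. \<exists>e. irred G e x"
      using A(1) B(1) C(1) by (metis union_iff)+
  qed
  obtain e x where x: "irred G e x" "char_ext d f = x \<or> char_ext d f = (\<lambda>g. - x g)"
    using virtual_character_norm_one[OF AB eq char_ext_norm[OF irr] finite_carrier] by blast
  have x1: "x \<one> = of_nat e" using x(1) character_one unfolding irred_def by blast
  have d1: "char_ext d f \<one> = of_nat d" by (rule char_ext_one[OF ch])
  show ?thesis
  proof (cases "char_ext d f = x")
    case True
    then have "d = e" using x1 d1 by simp
    then show ?thesis using True x(1) by simp
  next
    case False
    then have "of_nat d = - (of_nat e :: complex)" using x(2) x1 d1 by auto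
    then have "of_nat (d + e) = (0 :: complex)" by simp
    then show ?thesis using d by (simp only: of_nat_eq_0_iff)
  qed
qed

section \<open>The Frobenius kernel is a subgroup\<close>

definition kernel_set :: "'a set" where
  "kernel_set = {g \<in> carrier G. g = \<one> \<or> (\<forall>t\<in>carrier G. inv t \<otimes> g \<otimes> t \<notin> H)}"

text \<open>A nontrivial \<open>c\<close> in a conjugate of \<open>H\<close> is fixed under
  conjugation by \<open>k\<close>, so malnormality would put \<open>k\<close> into the same
  conjugate. This supplies a genuine group inside \<open>kernel_set\<close> before the latter is
  known to be one.\<close>

lemma centralizer_subset_kernel:
  assumes "k \<in> kernel_set" "k \<noteq> \<one>" "c \<in> carrier G" "c \<otimes> k = k \<otimes> c"
  shows "c \<in> kernel_set"
proof (rule ccontr)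
  assume "c \<notin> kernel_set"
  then obtain t where t: "c \<noteq> \<one>" "t \<in> carrier G" "inv t \<otimes> c \<otimes> t \<in> H"
    using assms(3) unfolding kernel_set_def by auto
  have k: "k \<in> carrier G" using assms(1) unfolding kernel_set_def by simp
  let ?h = "inv t \<otimes> c \<otimes> t" and ?k = "inv t \<otimes> k \<otimes> t"
  have tt: "t \<otimes> (inv t \<otimes> x) = x" if "x \<in> carrier G" for x
    using that t by (simp add: m_assoc[symmetric])
  have "?k \<otimes> ?h = ?h \<otimes> ?k"
    using t(2) k assms(3) tt assms(4)[symmetric] m_assoc[of k c t] m_assoc[of c k t] by (simp add: m_assoc)
  then have "?k \<otimes> ?h \<otimes> inv ?k = ?h" using t k assms(3) by (simp add: inv_solve_right')
  moreover have "?h \<noteq> \<one>"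
  proof
    assume "?h = \<one>"
    then have "t \<otimes> ?h \<otimes> inv t = \<one>" using t by simp
    moreover have "t \<otimes> ?h \<otimes> inv t = c" using t assms(3) by (simp add: m_assoc[symmetric]) (simp add: m_assoc)
    ultimately show False using t(1) by simp
  qed
  ultimately have "?k \<in> H" using malnormal[of ?k ?h] t k by simp
  then show False using assms(1,2) t unfolding kernel_set_def by auto
qed

lemma char_ext_kernel:
  assumes "irred GH d f" "k \<in> kernel_set"
  shows "char_ext d f k = of_nat d"
  using assms char_ext_one[of d f] char_ext_not_in_conj[of k d f] transversal_carrier
  unfolding kernel_set_def irred_def by auto

lemma conj_conj:
  assumes "t \<in> carrier G" "a \<in> carrier G" "z \<in> carrier G"
  shows "inv t \<otimes> z \<otimes> t = (inv t \<otimes> a) \<otimes> (inv a \<otimes> z \<otimes> a) \<otimes> inv (inv t \<otimes> a)"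
proof -
  have "a \<otimes> (inv a \<otimes> x) = x" if "x \<in> carrier G" for x
    using that assms by (simp add: m_assoc[symmetric])
  then show ?thesis using assms by (simp add: m_assoc inv_mult_group)
qed

lemma kernel_mult_closed:
  assumes "k \<in> kernel_set" "l \<in> kernel_set"
  shows "k \<otimes> l \<in> kernel_set"
proof (rule ccontr)
  assume n: "k \<otimes> l \<notin> kernel_set"
  have kl: "k \<in> carrier G" "l \<in> carrier G" using assms unfolding kernel_set_def by auto
  let ?z = "k \<otimes> l"
  obtain a where a: "?z \<noteq> \<one>" "a \<in> carrier G" "inv a \<otimes> ?z \<otimes> a \<in> H"
    using n kl unfolding kernel_set_def by auto
  have z: "?z \<in> carrier G" using kl by simp
  obtain t where t: "t \<in> transversal" "inv t \<otimes> a \<in> H" using transversal_ex1[OF a(2)] by blast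
  note tc = transversal_carrier[OF t(1)]
  \<comment> \<open>\<open>char_ext\<close> sums over the transversal only, so the conjugating
    element \<open>a\<close> is replaced by the representative of its coset, which changes the
    conjugate by an element of \<open>H\<close>.\<close>
  have tz: "inv t \<otimes> ?z \<otimes> t \<in> H"
  proof -
    have "inv t \<otimes> ?z \<otimes> t = (inv t \<otimes> a) \<otimes> (inv a \<otimes> ?z \<otimes> a) \<otimes> inv (inv t \<otimes> a)"
      by (rule conj_conj[OF tc a(2) z])
    then show ?thesis using t a m_closed m_inv_closed by simp
  qed
  have z1: "inv t \<otimes> ?z \<otimes> t \<noteq> \<one>"
  proof
    assume h: "inv t \<otimes> ?z \<otimes> t = \<one>"
    have "t \<otimes> (inv t \<otimes> ?z \<otimes> t) \<otimes> inv t = ?z" using tc z by (simp add: m_assoc[symmetric]) (simp add: m_assoc)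
    then show False using h a(1) tc by simp
  qed
  have finH: "finite (carrier GH)" using finite_carrier subset finite_subset by auto
  obtain d f where f: "irred GH d f" "f (inv t \<otimes> ?z \<otimes> t) \<noteq> of_nat d"
    using group.irred_separates[OF group_GH finH, of "inv t \<otimes> ?z \<otimes> t"] tz z1 by auto
  obtain \<rho> where \<rho>: "is_rep G d \<rho>" "char_ext d f = rep_char G \<rho>"
    using char_ext_irred[OF f(1)] unfolding irred_def character_def by auto
  \<comment> \<open>The trace is \<open>d\<close> not only at \<open>k\<close> but on the whole
    centralizer of \<open>k\<close>, where \<open>constant_trace_rep_trivial\<close>
    applies.\<close>
  have triv: "\<rho> k = 1\<^sub>m d" if k: "k \<in> kernel_set" for k
  proof (cases "k = \<one>")
    case True
    then show ?thesis using is_repD(2)[OF \<rho>(1)] by simp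
  next
    case False
    have kc: "k \<in> carrier G" using k unfolding kernel_set_def by simp
    define C where "C = {c \<in> carrier G. c \<otimes> k = k \<otimes> c}"
    have C: "subgroup C G"
    proof
      fix x y assume "x \<in> C" "y \<in> C"
      then have *: "x \<in> carrier G" "y \<in> carrier G" "x \<otimes> k = k \<otimes> x" "y \<otimes> k = k \<otimes> y" unfolding C_def by auto
      have "x \<otimes> y \<otimes> k = x \<otimes> (k \<otimes> y)" using * kc by (simp add: m_assoc)
      also have "\<dots> = k \<otimes> (x \<otimes> y)" using * kc by (simp add: m_assoc[symmetric])
      finally show "x \<otimes> y \<in> C" unfolding C_def using * by simp
    next
      fix x assume "x \<in> C"
      then have *: "x \<in> carrier G" "x \<otimes> k = k \<otimes> x" unfolding C_def by auto
      have "inv x \<otimes> k = inv x \<otimes> (k \<otimes> x) \<otimes> inv x" using * kc by (simp add: m_assoc)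
      also have "\<dots> = k \<otimes> inv x" unfolding *(2)[symmetric] using *(1) kc by (simp add: m_assoc[symmetric])
      finally show "inv x \<in> C" unfolding C_def using * by simp
    qed (auto simp: C_def kc)
    interpret C: group "G\<lparr>carrier := C\<rparr>" by (rule subgroup.subgroup_is_group[OF C is_group])
    have "mat_trace (\<rho> c) = of_nat d" if "c \<in> C" for c
    proof -
      have c: "c \<in> kernel_set" using centralizer_subset_kernel[OF k False] that unfolding C_def by simp
      then have "c \<in> carrier G" unfolding kernel_set_def by simp
      then show ?thesis using char_ext_kernel[OF f(1) c] \<rho>(2) by (simp add: rep_char_def)
    qed
    moreover have "finite C" using finite_carrier unfolding C_def by simp
    moreover have "k \<in> C" unfolding C_def using kc by simp
    ultimately show ?thesis
      using C.constant_trace_rep_trivial[of d \<rho> k] rep_restrict[OF \<rho>(1) C] by simp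
  qed
  have "\<rho> ?z = 1\<^sub>m d" using is_repD(3)[OF \<rho>(1) kl] triv[OF assms(1)] triv[OF assms(2)] by simp
  then have "char_ext d f ?z = of_nat d"
    unfolding \<rho>(2) using z by (simp add: rep_char_def mat_trace_def)
  moreover have "char_ext d f ?z = f (inv t \<otimes> ?z \<otimes> t)"
    by (rule char_ext_in_conj[OF z a(1) t(1) tz])
  ultimately show False using f(2) by simp
qed

lemma kernel_inv_closed:
  assumes "k \<in> kernel_set"
  shows "inv k \<in> kernel_set"
proof -
  have k: "k \<in> carrier G" using assms unfolding kernel_set_def by simp
  have "inv t \<otimes> k \<otimes> t \<in> H" if "t \<in> carrier G" "inv t \<otimes> inv k \<otimes> t \<in> H" for t
    using m_inv_closed[OF that(2)] unfolding inv_conj[OF k that(1)] using that(1) k by simp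
  then show ?thesis using assms unfolding kernel_set_def by auto
qed

end

section \<open>Malnormal subgroups next to one of order two\<close>

lemma (in group) involution_commute:
  assumes "u \<in> carrier G" "w \<in> carrier G" "u \<otimes> u = \<one>" "w \<otimes> w = \<one>" "(u \<otimes> w) \<otimes> (u \<otimes> w) = \<one>"
  shows "u \<otimes> w = w \<otimes> u"
proof -
  have "inv u = u" "inv w = w" using assms by (auto intro: inv_equality)
  moreover have "inv (u \<otimes> w) = u \<otimes> w" using assms by (auto intro: inv_equality)
  ultimately show ?thesis using inv_mult_group[OF assms(1,2)] by simp
qed

text \<open>The conjugates of the involution generating \<open>H\<close> make up half of \<open>G\<close>. The product of any two
  of them lies in the other half \<open>K\<close>, so each of them inverts every element of \<open>K\<close>, and the
  elements of \<open>K\<close> commute with each other. A malnormal \<open>L\<close> that meets \<open>K\<close> nontrivially would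
  therefore contain all of \<open>G\<close>.\<close>

lemma malnormal_card_two:
  assumes "malnormal G H" "card H = 2" and "malnormal G L" "L \<noteq> {\<one>\<^bsub>G\<^esub>}" "L \<noteq> carrier G"
  shows "card L = 2"
proof -
  interpret H: malnormal G H by fact
  interpret L: malnormal G L by fact
  note [simp] = H.m_assoc
  obtain t where t: "t \<noteq> \<one>\<^bsub>G\<^esub>" "H = {\<one>\<^bsub>G\<^esub>, t}"
  proof -
    obtain x y where xy: "H = {x, y}" "x \<noteq> y" using assms(2) by (auto simp: card_2_iff)
    then consider "\<one>\<^bsub>G\<^esub> = x" | "\<one>\<^bsub>G\<^esub> = y" using H.one_closed by auto
    then show thesis using that[of x] that[of y] xy by cases auto
  qed
  have tc: "t \<in> carrier G" using t H.subset by auto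
  have tt: "t \<otimes>\<^bsub>G\<^esub> t = \<one>\<^bsub>G\<^esub>"
    using H.m_closed[of t t] t tc by auto
  have cent: "g \<in> H" if "g \<in> carrier G" "g \<otimes>\<^bsub>G\<^esub> t = t \<otimes>\<^bsub>G\<^esub> g" for g
  proof (rule H.malnormal[OF that(1) _ t(1)])
    have "g \<otimes>\<^bsub>G\<^esub> t \<otimes>\<^bsub>G\<^esub> inv\<^bsub>G\<^esub> g = t" unfolding that(2) using that(1) tc by simp
    then show "g \<otimes>\<^bsub>G\<^esub> t \<otimes>\<^bsub>G\<^esub> inv\<^bsub>G\<^esub> g \<in> H" using t by simp
  qed (use t in simp)
  let ?c = "\<lambda>s. s \<otimes>\<^bsub>G\<^esub> t \<otimes>\<^bsub>G\<^esub> inv\<^bsub>G\<^esub> s"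
  define T where "T = ?c ` H.transversal"
  note trc = H.transversal_carrier
  have conj_cancel: "inv\<^bsub>G\<^esub> s \<otimes>\<^bsub>G\<^esub> (s \<otimes>\<^bsub>G\<^esub> x) = x" "s \<otimes>\<^bsub>G\<^esub> (inv\<^bsub>G\<^esub> s \<otimes>\<^bsub>G\<^esub> x) = x"
    if "s \<in> carrier G" "x \<in> carrier G" for s x
    using that by (simp_all add: H.m_assoc[symmetric] del: H.m_assoc)
  \<comment> \<open>Conjugating by \<open>s\<close> reduces this to the centralizer of
    \<open>t\<close>, which \<open>cent\<close> places in \<open>H\<close>.\<close>
  have centT: "g = \<one>\<^bsub>G\<^esub> \<or> g = u" if u: "u \<in> T" and g: "g \<in> carrier G" "g \<otimes>\<^bsub>G\<^esub> u = u \<otimes>\<^bsub>G\<^esub> g" for u g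
  proof -
    obtain s where s: "s \<in> carrier G" "u = ?c s" using u trc unfolding T_def by auto
    let ?g = "inv\<^bsub>G\<^esub> s \<otimes>\<^bsub>G\<^esub> g \<otimes>\<^bsub>G\<^esub> s"
    have "?g \<otimes>\<^bsub>G\<^esub> t = inv\<^bsub>G\<^esub> s \<otimes>\<^bsub>G\<^esub> (g \<otimes>\<^bsub>G\<^esub> u) \<otimes>\<^bsub>G\<^esub> s"
      using s g(1) tc by (simp add: conj_cancel)
    also have "\<dots> = t \<otimes>\<^bsub>G\<^esub> ?g"
      unfolding g(2) using s g(1) tc by (simp add: conj_cancel)
    finally have "?g \<in> H" using cent s g(1) by simp
    then have "?g = \<one>\<^bsub>G\<^esub> \<or> ?g = t" unfolding t(2) by blast
    then have "s \<otimes>\<^bsub>G\<^esub> ?g \<otimes>\<^bsub>G\<^esub> inv\<^bsub>G\<^esub> s = \<one>\<^bsub>G\<^esub> \<or> s \<otimes>\<^bsub>G\<^esub> ?g \<otimes>\<^bsub>G\<^esub> inv\<^bsub>G\<^esub> s = u"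
      using s by (elim disjE) simp_all
    moreover have "s \<otimes>\<^bsub>G\<^esub> ?g \<otimes>\<^bsub>G\<^esub> inv\<^bsub>G\<^esub> s = g" using s g(1) by (simp add: conj_cancel)
    ultimately show ?thesis by simp
  qed
  have T: "u \<in> carrier G" "u \<otimes>\<^bsub>G\<^esub> u = \<one>\<^bsub>G\<^esub>" "u \<noteq> \<one>\<^bsub>G\<^esub>" if u: "u \<in> T" for u
  proof -
    obtain s where s: "s \<in> carrier G" "u = ?c s" using u trc unfolding T_def by auto
    show "u \<in> carrier G" using s tc by simp
    have "t \<otimes>\<^bsub>G\<^esub> (t \<otimes>\<^bsub>G\<^esub> x) = x" if "x \<in> carrier G" for x
      using that tt tc by (simp add: H.m_assoc[symmetric] del: H.m_assoc)
    then show "u \<otimes>\<^bsub>G\<^esub> u = \<one>\<^bsub>G\<^esub>" using s tc by (simp add: conj_cancel)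
    show "u \<noteq> \<one>\<^bsub>G\<^esub>"
    proof
      assume "u = \<one>\<^bsub>G\<^esub>"
      then have "inv\<^bsub>G\<^esub> s \<otimes>\<^bsub>G\<^esub> u \<otimes>\<^bsub>G\<^esub> s = \<one>\<^bsub>G\<^esub>" using s by simp
      moreover have "inv\<^bsub>G\<^esub> s \<otimes>\<^bsub>G\<^esub> u \<otimes>\<^bsub>G\<^esub> s = t" using s tc by (simp add: conj_cancel)
      ultimately show False using t by simp
    qed
  qed
  have "inj_on ?c H.transversal"
  proof (rule inj_onI)
    fix s u assume su: "s \<in> H.transversal" "u \<in> H.transversal" "?c s = ?c u"
    note c = trc[OF su(1)] trc[OF su(2)]
    let ?k = "inv\<^bsub>G\<^esub> u \<otimes>\<^bsub>G\<^esub> s"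
    have "?k \<otimes>\<^bsub>G\<^esub> t = inv\<^bsub>G\<^esub> u \<otimes>\<^bsub>G\<^esub> ?c s \<otimes>\<^bsub>G\<^esub> s" using c tc by (simp add: conj_cancel)
    also have "\<dots> = t \<otimes>\<^bsub>G\<^esub> ?k" unfolding su(3) using c tc by (simp add: conj_cancel)
    finally have "?k \<in> H" using cent c by simp
    then show "s = u" using H.transversal_eqI[OF su(2,1)] by simp
  qed
  then have cardT: "card T * 2 = card (carrier G)"
    unfolding T_def using H.card_transversal assms(2) by (simp add: card_image)
  have fin: "finite (carrier G)" by (rule H.finite_carrier)
  have finT: "finite T" unfolding T_def using H.finite_transversal by simp
  \<comment> \<open>If \<open>u \<otimes> w\<close> were in \<open>T\<close>, then \<open>u\<close>,
    \<open>w\<close> and their product would be involutions, so \<open>u\<close> and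
    \<open>w\<close> would commute; \<open>centT\<close> forces \<open>w = u\<close>, and the
    product would be the identity. Equal cardinalities turn the inclusion into an equality.\<close>
  have TT: "(\<lambda>w. u \<otimes>\<^bsub>G\<^esub> w) ` T = carrier G - T" if u: "u \<in> T" for u
  proof (rule card_subset_eq)
    show "(\<lambda>w. u \<otimes>\<^bsub>G\<^esub> w) ` T \<subseteq> carrier G - T"
    proof safe
      fix w assume w: "w \<in> T"
      then show "u \<otimes>\<^bsub>G\<^esub> w \<in> carrier G" using T(1) u by simp
      assume "u \<otimes>\<^bsub>G\<^esub> w \<in> T"
      then have "u \<otimes>\<^bsub>G\<^esub> w = w \<otimes>\<^bsub>G\<^esub> u" "u \<otimes>\<^bsub>G\<^esub> w \<noteq> \<one>\<^bsub>G\<^esub>"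
        using H.involution_commute[OF T(1)[OF u] T(1)[OF w] T(2)[OF u] T(2)[OF w]] T by blast+
      then have "w = u" using centT[OF u T(1)[OF w]] T(3)[OF w] by simp
      then show False using T(2)[OF u] \<open>u \<otimes>\<^bsub>G\<^esub> w \<noteq> \<one>\<^bsub>G\<^esub>\<close> by simp
    qed
    have "inj_on (\<lambda>w. u \<otimes>\<^bsub>G\<^esub> w) T" using T(1) u by (auto intro!: inj_onI)
    then have "card ((\<lambda>w. u \<otimes>\<^bsub>G\<^esub> w) ` T) = card T" by (rule card_image)
    also have "\<dots> = card (carrier G - T)"
      using cardT finT T(1) by (subst card_Diff_subset) auto
    finally show "card ((\<lambda>w. u \<otimes>\<^bsub>G\<^esub> w) ` T) = card (carrier G - T)" .
  qed (use fin in simp)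
  \<comment> \<open>By \<open>TT\<close>, \<open>k = u \<otimes> w\<close> for an involution
    \<open>w\<close>; conjugation by \<open>u\<close> gives \<open>w \<otimes> u\<close>, the
    inverse of \<open>k\<close>.\<close>
  have Kinv: "u \<otimes>\<^bsub>G\<^esub> k \<otimes>\<^bsub>G\<^esub> inv\<^bsub>G\<^esub> u = inv\<^bsub>G\<^esub> k" if u: "u \<in> T" and k: "k \<in> carrier G - T" for u k
  proof -
    obtain w where w: "w \<in> T" "k = u \<otimes>\<^bsub>G\<^esub> w" using TT[OF u] k by blast
    have iu: "inv\<^bsub>G\<^esub> u = u" and iw: "inv\<^bsub>G\<^esub> w = w" using T u w by (auto intro: H.inv_equality)
    have "u \<otimes>\<^bsub>G\<^esub> (u \<otimes>\<^bsub>G\<^esub> x) = x" if "x \<in> carrier G" for x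
      using conj_cancel(1)[OF T(1)[OF u] that] iu by simp
    then show ?thesis using T(1)[OF u] T(1)[OF w(1)] iu iw by (simp add: w(2) H.inv_mult_group)
  qed
  obtain u0 where u0: "u0 \<in> T"
  proof -
    have "card (carrier G) \<noteq> 0" using fin H.one_closed by auto
    then have "T \<noteq> {}" using cardT by auto
    then show thesis using that by auto
  qed
  \<comment> \<open>\<open>l\<close> is a product of two elements of \<open>T\<close>, so
    conjugation by \<open>l\<close> inverts \<open>k\<close> twice.\<close>
  have Kcomm: "l \<otimes>\<^bsub>G\<^esub> k \<otimes>\<^bsub>G\<^esub> inv\<^bsub>G\<^esub> l = k" if k: "k \<in> carrier G - T" and l: "l \<in> carrier G - T" for k l
  proof -
    obtain w where w: "w \<in> T" "l = u0 \<otimes>\<^bsub>G\<^esub> w" using TT[OF u0] l by blast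
    have kc: "k \<in> carrier G" using k by simp
    have "l \<otimes>\<^bsub>G\<^esub> k \<otimes>\<^bsub>G\<^esub> inv\<^bsub>G\<^esub> l = u0 \<otimes>\<^bsub>G\<^esub> (w \<otimes>\<^bsub>G\<^esub> k \<otimes>\<^bsub>G\<^esub> inv\<^bsub>G\<^esub> w) \<otimes>\<^bsub>G\<^esub> inv\<^bsub>G\<^esub> u0"
      using T(1)[OF u0] T(1)[OF w(1)] kc by (simp add: w(2) H.inv_mult_group)
    also have "\<dots> = inv\<^bsub>G\<^esub> (u0 \<otimes>\<^bsub>G\<^esub> k \<otimes>\<^bsub>G\<^esub> inv\<^bsub>G\<^esub> u0)"
      unfolding Kinv[OF w(1) k] using T(1)[OF u0] kc by (simp add: H.inv_mult_group)
    also have "\<dots> = k" unfolding Kinv[OF u0 k] using kc by simp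
    finally show ?thesis .
  qed
  have LT: "x \<in> T" if x: "x \<in> L" "x \<noteq> \<one>\<^bsub>G\<^esub>" for x
  proof (rule ccontr)
    assume "x \<notin> T"
    then have xK: "x \<in> carrier G - T" using x L.subset by auto
    have "g \<in> L" if g: "g \<in> carrier G" for g
    proof (rule L.malnormal[OF g x])
      show "g \<otimes>\<^bsub>G\<^esub> x \<otimes>\<^bsub>G\<^esub> inv\<^bsub>G\<^esub> g \<in> L"
        using Kinv[OF _ xK, of g] Kcomm[OF xK, of g] g x(1) L.m_inv_closed by (cases "g \<in> T") auto
    qed
    then show False using assms(5) L.subset by auto
  qed
  \<comment> \<open>Both elements lie in \<open>T\<close>, so their product lies outside
    \<open>T\<close> but in \<open>L\<close>, hence is the identity; being involutions, they
    coincide.\<close>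
  have eq: "x = y" if x: "x \<in> L" "x \<noteq> \<one>\<^bsub>G\<^esub>" and y: "y \<in> L" "y \<noteq> \<one>\<^bsub>G\<^esub>" for x y
  proof -
    have "x \<otimes>\<^bsub>G\<^esub> y \<in> carrier G - T" using TT[OF LT[OF x]] LT[OF y] by blast
    then have "x \<otimes>\<^bsub>G\<^esub> y = \<one>\<^bsub>G\<^esub>" using LT[of "x \<otimes>\<^bsub>G\<^esub> y"] x y by auto
    then have "inv\<^bsub>G\<^esub> y = x" using H.inv_equality T(1) LT[OF x] LT[OF y] by blast
    moreover have "inv\<^bsub>G\<^esub> y = y" using T LT[OF y] by (intro H.inv_equality) auto
    ultimately show ?thesis by simp
  qed
  obtain x where x: "x \<in> L" "x \<noteq> \<one>\<^bsub>G\<^esub>" using assms(4) L.one_closed by blast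
  have "L = {\<one>\<^bsub>G\<^esub>, x}" using L.one_closed x eq[OF x] by blast
  then show ?thesis using x by simp
qed

section \<open>Frobenius permutation groups\<close>

locale frobenius_perm_group =
  fixes n :: nat and G :: "(nat \<Rightarrow> nat) set"
  assumes frobenius: "frobenius_group n G"
begin

abbreviation \<Omega> where "\<Omega> \<equiv> {1..n}"
abbreviation Stab where "Stab \<equiv> point_stabilizer G"
abbreviation PG where "PG \<equiv> sym_group n\<lparr>carrier := G\<rparr>"

lemma subgroup_G: "subgroup G (sym_group n)"
  using frobenius unfolding frobenius_group_def transitive_perm_group_def by simp

lemma permutes: "g \<in> G \<Longrightarrow> g permutes \<Omega>"
  using subgroup.subset[OF subgroup_G] by (auto simp: sym_group_def)

lemma in_sym: "g \<in> G \<Longrightarrow> g \<in> carrier (sym_group n)"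
  using subgroup.subset[OF subgroup_G] by auto

lemma finite_G: "finite G"
  using finite_subset[OF _ finite_permutations[of \<Omega>]] permutes by auto

lemma comp_closed: "g \<in> G \<Longrightarrow> h \<in> G \<Longrightarrow> g \<circ> h \<in> G"
  using subgroup.m_closed[OF subgroup_G] by (simp add: sym_group_mult)

lemma id_closed: "id \<in> G"
  using subgroup.one_closed[OF subgroup_G] by (simp add: sym_group_one)

lemma inv_closed: "g \<in> G \<Longrightarrow> inv' g \<in> G"
  using subgroup.m_inv_closed[OF subgroup_G] in_sym by fastforce

lemma inverse_simps [simp]:
  assumes "g \<in> G"
  shows "inv' g (g x) = x" "g (inv' g x) = x" "inv' g \<circ> g = id" "g \<circ> inv' g = id"
  using permutes_inverses[OF permutes[OF assms]] permutes_inv_o[OF permutes[OF assms]] by auto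

lemma in_Omega [simp]: "g \<in> G \<Longrightarrow> g x \<in> \<Omega> \<longleftrightarrow> x \<in> \<Omega>"
  using permutes_in_image[OF permutes] by blast

lemma transitive:
  assumes "x \<in> \<Omega>" "y \<in> \<Omega>"
  obtains g where "g \<in> G" "g x = y"
  using assms frobenius unfolding frobenius_group_def transitive_perm_group_def by blast

lemma two_fixed_points:
  assumes "g \<in> G" "x \<in> \<Omega>" "y \<in> \<Omega>" "g x = x" "g y = y" "x \<noteq> y"
  shows "g = id"
proof (rule ccontr)
  assume "g \<noteq> id"
  then have "card (fixed_points n g) \<le> 1" using assms(1) frobenius unfolding frobenius_group_def by auto
  moreover have "{x, y} \<subseteq> fixed_points n g" using assms unfolding fixed_points_def by auto
  then have "card {x, y} \<le> card (fixed_points n g)" by (rule card_mono[rotated]) (simp add: fixed_points_def)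
  ultimately show False using assms(6) by simp
qed

lemma intersect_iff:
  assumes "s \<in> G" "t \<in> G"
  shows "perms_intersect n s t \<longleftrightarrow> (\<exists>x\<in>\<Omega>. s x = t x)"
proof -
  have "perms_intersect n s t \<longleftrightarrow> (\<exists>x\<in>\<Omega>. s (inv' t x) = x)"
    unfolding perms_intersect_def fixed_points_def
    using sym_group_inv_equality[OF in_sym[OF assms(2)]] by (auto simp: sym_group_mult)
  also have "\<dots> \<longleftrightarrow> (\<exists>x\<in>\<Omega>. s x = t x)"
    using assms by (metis in_Omega inverse_simps(1,2))
  finally show ?thesis .
qed

section \<open>Orders of stabilizers and the number of derangements\<close>

lemma card_coset:
  assumes "a \<in> G" "x \<in> \<Omega>"
  shows "card {g \<in> G. g x = a x} = card (Stab x)"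
proof (rule bij_betw_same_card[symmetric])
  show "bij_betw (\<lambda>g. a \<circ> g) (Stab x) {g \<in> G. g x = a x}"
    by (rule bij_betw_byWitness[where f' = "\<lambda>g. inv' a \<circ> g"])
      (use assms in \<open>auto simp: point_stabilizer_def comp_closed inv_closed fun_eq_iff\<close>)
qed

lemma card_G_Stab:
  assumes "x \<in> \<Omega>"
  shows "card G = n * card (Stab x)"
proof -
  have "card G = (\<Sum>y\<in>\<Omega>. card {g \<in> G. g x = y})"
  proof -
    have "G = (\<Union>y\<in>\<Omega>. {g \<in> G. g x = y})" using in_Omega assms by blast
    then show ?thesis
      using card_UN_disjoint[of \<Omega> "\<lambda>y. {g \<in> G. g x = y}"] finite_G by auto
  qed
  also have "\<dots> = (\<Sum>y\<in>\<Omega>. card (Stab x))"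
  proof (rule sum.cong[OF refl])
    fix y assume "y \<in> \<Omega>"
    then obtain a where "a \<in> G" "a x = y" using transitive[OF assms] by blast
    then show "card {g \<in> G. g x = y} = card (Stab x)" using card_coset[OF _ assms] by auto
  qed
  finally show ?thesis by simp
qed

lemma nontrivial: obtains g x where "g \<in> G" "g \<noteq> id" "x \<in> \<Omega>" "g x = x"
  using frobenius unfolding frobenius_group_def fixed_points_def by blast

lemma n_ge_2: "n \<ge> 2"
proof -
  obtain g x where g: "g \<in> G" "g \<noteq> id" "x \<in> \<Omega>" by (rule nontrivial)
  obtain y where y: "g y \<noteq> y" using g(2) by (metis eq_id_iff)
  then have "y \<in> \<Omega>" "g y \<in> \<Omega>" using permutes[OF g(1)] g(1) by (auto simp: permutes_def)
  then show ?thesis using y by auto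
qed

text \<open>All stabilizers have order \<open>card G / n\<close>, so the maximum is taken over a
  single value.\<close>

lemma card_Stab_eq:
  assumes "x \<in> \<Omega>"
  shows "card (Stab x) = max_stabilizer_size n G"
proof -
  have "card (Stab y) = card (Stab x)" if "y \<in> \<Omega>" for y
    using card_G_Stab[OF assms] card_G_Stab[OF that] n_ge_2 by simp
  then have "(\<lambda>y. card (Stab y)) ` \<Omega> = (\<lambda>_. card (Stab x)) ` \<Omega>" by (rule image_cong[OF refl])
  also have "\<dots> = {card (Stab x)}" using assms by blast
  finally have "(\<lambda>y. card (Stab y)) ` \<Omega> = {card (Stab x)}" .
  then show ?thesis unfolding max_stabilizer_size_def by simp
qed

abbreviation h where "h \<equiv> max_stabilizer_size n G"

lemma card_G: "card G = n * h"
  using card_G_Stab[of 1] card_Stab_eq[of 1] n_ge_2 by simp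

lemma finite_Stab: "finite (Stab x)"
  using finite_G unfolding point_stabilizer_def by simp

lemma h_ge_2: "h \<ge> 2"
proof -
  obtain g x where g: "g \<in> G" "g \<noteq> id" "x \<in> \<Omega>" "g x = x" by (rule nontrivial)
  then have "{id, g} \<subseteq> Stab x" using id_closed unfolding point_stabilizer_def by auto
  then have "card {id, g} \<le> card (Stab x)" by (rule card_mono[OF finite_Stab])
  then show ?thesis using g card_Stab_eq[OF g(3)] by simp
qed

definition derangements :: "(nat \<Rightarrow> nat) set" where
  "derangements = {g \<in> G. \<forall>x\<in>\<Omega>. g x \<noteq> x}"

text \<open>The nontrivial parts of the \<open>n\<close> stabilizers are disjoint, since a
  non-identity element fixes at most one point. Removing them and the identity from
  \<open>n * h\<close> elements leaves \<open>n - 1\<close>.\<close>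

lemma card_derangements: "card derangements = n - 1"
proof -
  have G: "G = insert id (derangements \<union> (\<Union>x\<in>\<Omega>. Stab x - {id}))"
    using id_closed unfolding derangements_def point_stabilizer_def by auto
  have "card (\<Union>x\<in>\<Omega>. Stab x - {id}) = (\<Sum>x\<in>\<Omega>. card (Stab x - {id}))"
    using finite_Stab two_fixed_points by (intro card_UN_disjoint) (auto simp: point_stabilizer_def)
  also have "\<dots> = (\<Sum>x\<in>\<Omega>. h - 1)"
    using card_Stab_eq id_closed finite_Stab
    by (intro sum.cong) (auto simp: point_stabilizer_def card_Diff_singleton)
  finally have U: "card (\<Union>x\<in>\<Omega>. Stab x - {id}) = n * (h - 1)" by simp
  have fin: "finite derangements" "finite (\<Union>x\<in>\<Omega>. Stab x - {id})"
    using finite_G finite_Stab unfolding derangements_def by auto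
  have "id \<notin> derangements" using n_ge_2 unfolding derangements_def by auto
  then have "card G = Suc (card (derangements \<union> (\<Union>x\<in>\<Omega>. Stab x - {id})))"
    using fin by (subst G) (subst card_insert_disjoint, auto)
  also have "card (derangements \<union> (\<Union>x\<in>\<Omega>. Stab x - {id})) = card derangements + n * (h - 1)"
    unfolding U[symmetric] by (rule card_Un_disjoint[OF fin]) (auto simp: derangements_def point_stabilizer_def)
  finally have "n * h = Suc (card derangements + n * (h - 1))" unfolding card_G .
  moreover have "n * h = n * (h - 1) + n" using h_ge_2 by (cases h) auto
  ultimately show ?thesis by simp
qed

section \<open>Transfer from abstract groups to permutations\<close>

lemma group_PG: "group PG"
  by (rule subgroup.subgroup_is_group[OF subgroup_G sym_group_is_group])

lemma inv_PG: "g \<in> G \<Longrightarrow> inv\<^bsub>PG\<^esub> g = inv' g"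
  using group.m_inv_consistent[OF sym_group_is_group subgroup_G] in_sym by simp

lemma mult_PG: "g \<otimes>\<^bsub>PG\<^esub> k = g \<circ> k"
  by (simp add: sym_group_mult)

lemma one_PG: "\<one>\<^bsub>PG\<^esub> = id"
  by (simp add: sym_group_one)

lemma malnormal_PG:
  assumes "subgroup L (sym_group n)" "L \<subseteq> G"
    and "\<And>g l. g \<in> G \<Longrightarrow> l \<in> L \<Longrightarrow> l \<noteq> id \<Longrightarrow> g \<circ> l \<circ> inv' g \<in> L \<Longrightarrow> g \<in> L"
  shows "malnormal PG L"
proof (intro malnormal.intro malnormal_axioms.intro)
  show "subgroup L PG"
    by (rule group.subgroup_incl[OF sym_group_is_group assms(1) subgroup_G assms(2)])
  fix g l assume "g \<in> carrier PG" "l \<in> L" "l \<noteq> \<one>\<^bsub>PG\<^esub>" "g \<otimes>\<^bsub>PG\<^esub> l \<otimes>\<^bsub>PG\<^esub> inv\<^bsub>PG\<^esub> g \<in> L"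
  then show "g \<in> L" using assms(3)[of g l] inv_PG[of g] unfolding mult_PG one_PG by simp
qed (use group_PG finite_G in auto)

text \<open>If \<open>g \<circ> l \<circ> inv' g\<close> fixes \<open>x\<close>, then
  \<open>l\<close> fixes \<open>inv' g x\<close> as well as \<open>x\<close>; for \<open>l\<close>
  not the identity these two points coincide.\<close>

lemma malnormal_Stab:
  assumes "x \<in> \<Omega>"
  shows "malnormal PG (Stab x)"
proof (rule malnormal_PG)
  show "subgroup (Stab x) (sym_group n)"
  proof (rule subgroup.intro)
    show "inv\<^bsub>sym_group n\<^esub> g \<in> Stab x" if "g \<in> Stab x" for g
    proof -
      have g: "g \<in> G" "g x = x" using that unfolding point_stabilizer_def by auto
      then have "inv' g x = x" using inverse_simps(1)[OF g(1), of x] by simp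
      then show ?thesis using g in_sym inv_closed unfolding point_stabilizer_def by simp
    qed
  qed (auto simp: point_stabilizer_def sym_group_mult sym_group_one comp_closed id_closed in_sym)
  fix g l assume *: "g \<in> G" "l \<in> Stab x" "l \<noteq> id" "g \<circ> l \<circ> inv' g \<in> Stab x"
  then have l: "l \<in> G" "l x = x" "g (l (inv' g x)) = x" unfolding point_stabilizer_def by auto
  have "l (inv' g x) = inv' g x" using l(3) *(1) by (metis inverse_simps(1))
  then have "inv' g x = x"
    using two_fixed_points[OF l(1) _ assms _ l(2)] *(1,3) assms inv_closed by (metis in_Omega)
  then have "g x = x" using *(1) by (metis inverse_simps(2))
  then show "g \<in> Stab x" using *(1) unfolding point_stabilizer_def by simp
qed (auto simp: point_stabilizer_def)

text \<open>By transitivity every stabilizer is conjugate to that of 1, so avoiding all conjugates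
  of \<open>Stab 1\<close> means fixing no point.\<close>

lemma derangement_quotient:
  assumes "k \<in> insert id derangements" "l \<in> insert id derangements"
  shows "inv' k \<circ> l \<in> insert id derangements"
proof -
  have 1: "1 \<in> \<Omega>" using n_ge_2 by simp
  interpret M: malnormal PG "Stab 1" by (rule malnormal_Stab[OF 1])
  have eq: "M.kernel_set = insert id derangements"
  proof -
    have "(\<forall>t\<in>G. inv' t \<circ> g \<circ> t \<notin> Stab 1) \<longleftrightarrow> (\<forall>x\<in>\<Omega>. g x \<noteq> x)" if g: "g \<in> G" for g
    proof
      assume *: "\<forall>t\<in>G. inv' t \<circ> g \<circ> t \<notin> Stab 1"
      show "\<forall>x\<in>\<Omega>. g x \<noteq> x"
      proof
        fix x assume x: "x \<in> \<Omega>"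
        obtain t where t: "t \<in> G" "t 1 = x" using transitive[OF 1 x] by blast
        have "inv' t \<circ> g \<circ> t \<in> G" using t g comp_closed inv_closed by simp
        then have "inv' t (g x) \<noteq> 1" using * t unfolding point_stabilizer_def by auto
        then show "g x \<noteq> x" using t inverse_simps(1)[OF t(1), of 1] by auto
      qed
    next
      assume *: "\<forall>x\<in>\<Omega>. g x \<noteq> x"
      show "\<forall>t\<in>G. inv' t \<circ> g \<circ> t \<notin> Stab 1"
      proof
        fix t assume t: "t \<in> G"
        have "inv' t (g (t 1)) \<noteq> 1"
          using * t 1 by (metis in_Omega inverse_simps(2))
        then show "inv' t \<circ> g \<circ> t \<notin> Stab 1" unfolding point_stabilizer_def by simp
      qed
    qed
    then show ?thesis
      unfolding M.kernel_set_def derangements_def mult_PG one_PG using inv_PG id_closed by auto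
  qed
  have k: "k \<in> G" using assms(1) id_closed unfolding derangements_def by auto
  have "inv\<^bsub>PG\<^esub> k \<otimes>\<^bsub>PG\<^esub> l \<in> M.kernel_set"
    using assms unfolding eq[symmetric] by (intro M.kernel_mult_closed M.kernel_inv_closed)
  then show ?thesis unfolding eq mult_PG inv_PG[OF k] .
qed

text \<open>Disjointness of the cosets: if \<open>k \<circ> s = l \<circ> t\<close> and
  \<open>s\<close>, \<open>t\<close> agree at \<open>x\<close>, then \<open>inv' k \<circ> l\<close>
  fixes \<open>s x\<close>; lying in \<open>?K\<close>, it is the identity. In graph terms, this is
  the clique-coclique bound for the derangement graph with clique \<open>?K\<close>.\<close>

lemma EKR: "EKR n G"
  unfolding EKR_def
proof (intro allI impI)
  fix S assume S: "S \<subseteq> G \<and> intersecting n S"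
  let ?K = "insert id derangements"
  have KG: "?K \<subseteq> G" using id_closed unfolding derangements_def by auto
  have cardK: "card ?K = n"
    using card_derangements n_ge_2 finite_G unfolding derangements_def
    by (subst card_insert_disjoint) auto
  have "inj_on (\<lambda>(k, s). k \<circ> s) (?K \<times> S)"
  proof (rule inj_onI, clarify)
    fix k s l t assume *: "k \<in> ?K" "s \<in> S" "l \<in> ?K" "t \<in> S" "k \<circ> s = l \<circ> t"
    have G: "k \<in> G" "l \<in> G" "s \<in> G" "t \<in> G" using * KG S by auto
    obtain x where x: "x \<in> \<Omega>" "s x = t x"
      using S * intersect_iff[OF G(3,4)] unfolding intersecting_def by blast
    have "k (s x) = l (s x)" using fun_cong[OF *(5), of x] x(2) by simp
    then have "(inv' k \<circ> l) (s x) = s x" using G inverse_simps(1)[OF G(1), of "s x"] by simp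
    moreover have "s x \<in> \<Omega>" using in_Omega[OF G(3)] x(1) by blast
    moreover have "inv' k \<circ> l \<in> ?K" using derangement_quotient * by blast
    ultimately have "inv' k \<circ> l = id" unfolding derangements_def by auto
    then have kl: "k = l" using G by (metis comp_assoc comp_id id_comp inverse_simps(4))
    moreover have "s = t"
    proof
      fix y show "s y = t y"
        using fun_cong[OF *(5), of y] inverse_simps(1)[OF G(1)] kl by (metis comp_apply)
    qed
    ultimately show "k = l \<and> s = t" by simp
  qed
  moreover have "(\<lambda>(k, s). k \<circ> s) ` (?K \<times> S) \<subseteq> G" using comp_closed KG S by auto
  ultimately have "card (?K \<times> S) \<le> card G" by (rule card_inj_on_le[OF _ _ finite_G])
  then have "n * card S \<le> n * h" using card_G cardK by (simp add: card_cartesian_product)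
  then show "card S \<le> h" using n_ge_2 by simp
qed

lemma strict_EKR_if_two:
  assumes "h = 2"
  shows "strict_EKR n G"
  unfolding strict_EKR_def
proof (intro conjI EKR allI impI)
  fix S assume S: "S \<subseteq> G \<and> intersecting n S \<and> card S = h"
  then obtain s t where st: "S = {s, t}" "s \<noteq> t" using assms by (metis card_2_iff)
  then have G: "s \<in> G" "t \<in> G" using S by auto
  obtain x where x: "x \<in> \<Omega>" "s x = t x"
    using S st intersect_iff[OF G] unfolding intersecting_def by blast
  let ?C = "s <#\<^bsub>sym_group n\<^esub> Stab x"
  have C: "?C = (\<lambda>g. s \<circ> g) ` Stab x" unfolding l_coset_def sym_group_mult by auto
  have "inv' s \<circ> t \<in> Stab x"
    using G x comp_closed inv_closed inverse_simps(1)[OF G(1), of x] unfolding point_stabilizer_def by auto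
  then have "s \<circ> (inv' s \<circ> t) \<in> ?C" unfolding C by blast
  then have "t \<in> ?C" using G by (simp add: comp_assoc[symmetric])
  moreover have "s \<in> ?C" unfolding C using id_closed by (intro image_eqI[of _ _ id]) (auto simp: point_stabilizer_def)
  ultimately have "S \<subseteq> ?C" using st by auto
  moreover have "card ?C \<le> card S"
    unfolding C using card_image_le[OF finite_Stab, of "\<lambda>g. s \<circ> g" x] card_Stab_eq[OF x(1)] S by simp
  moreover have "finite ?C" unfolding C using finite_Stab by simp
  ultimately have "S = ?C" by (rule card_seteq[rotated])
  then show "\<exists>x\<in>\<Omega>. \<exists>g\<in>G. S = g <#\<^bsub>sym_group n\<^esub> Stab x" using x G by blast
qed

text \<open>Right multiplication by \<open>s\<close> matches these elements with the derangements.
  In graph terms, the derangement graph is regular of degree \<open>n - 1\<close>.\<close>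

lemma card_not_intersecting:
  assumes "s \<in> G"
  shows "card {g \<in> G. \<not> perms_intersect n g s} = n - 1"
proof -
  have "bij_betw (\<lambda>g. g \<circ> s) derangements {g \<in> G. \<not> perms_intersect n g s}"
  proof (rule bij_betw_byWitness[where f' = "\<lambda>g. g \<circ> inv' s"])
    show "(\<lambda>g. g \<circ> s) ` derangements \<subseteq> {g \<in> G. \<not> perms_intersect n g s}"
    proof safe
      fix g assume g: "g \<in> derangements"
      then have gG: "g \<in> G" unfolding derangements_def by simp
      then show "g \<circ> s \<in> G" using assms by (rule comp_closed)
      assume "perms_intersect n (g \<circ> s) s"
      then obtain x where "x \<in> \<Omega>" "g (s x) = s x"
        using intersect_iff[OF comp_closed[OF gG assms] assms] by auto
      then show False using g in_Omega[OF assms] unfolding derangements_def by blast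
    qed
    show "(\<lambda>g. g \<circ> inv' s) ` {g \<in> G. \<not> perms_intersect n g s} \<subseteq> derangements"
    proof safe
      fix g assume g: "g \<in> G" "\<not> perms_intersect n g s"
      have "g (inv' s x) \<noteq> x" if "x \<in> \<Omega>" for x
        using g intersect_iff[OF g(1) assms] that assms inv_closed by (metis in_Omega inverse_simps(2))
      then show "g \<circ> inv' s \<in> derangements"
        unfolding derangements_def using g assms comp_closed inv_closed by auto
    qed
  qed (use assms in \<open>auto simp: comp_assoc\<close>)
  from bij_betw_same_card[OF this] show ?thesis using card_derangements by simp
qed

text \<open>For stabilizers of order \<open>h \<ge> 3\<close>, one element of a stabilizer can be exchanged for an
  element outside of it that intersects all the others: these exclude at most \<open>(h - 1) * (n - 1)\<close>
  elements, and the remaining \<open>n * h - (h - 1) * (n - 1) = n + h - 1\<close> are more than \<open>h\<close>.\<close>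

lemma two_if_strict_EKR:
  assumes "strict_EKR n G"
  shows "h = 2"
proof (rule ccontr)
  assume "h \<noteq> 2"
  then have h3: "h \<ge> 3" using h_ge_2 by simp
  have 1: "1 \<in> \<Omega>" using n_ge_2 by simp
  let ?A = "Stab 1"
  have cA: "card ?A = h" by (rule card_Stab_eq[OF 1])
  obtain a where a: "a \<in> ?A"
  proof
    show "id \<in> ?A" using id_closed unfolding point_stabilizer_def by simp
  qed
  define B where "B = ?A - {a}"
  have cB: "card B = h - 1" and fB: "finite B" using a cA finite_Stab unfolding B_def by auto
  have BG: "B \<subseteq> G" unfolding B_def point_stabilizer_def by auto
  define Bad where "Bad = (\<Union>s\<in>B. {g \<in> G. \<not> perms_intersect n g s})"
  have "card Bad \<le> (\<Sum>s\<in>B. card {g \<in> G. \<not> perms_intersect n g s})"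
    unfolding Bad_def by (rule card_UN_le[OF fB])
  also have "\<dots> = (\<Sum>s\<in>B. n - 1)" using card_not_intersecting BG by (intro sum.cong) auto
  finally have cBad: "card Bad \<le> (h - 1) * (n - 1)" using cB by simp
  have "\<not> G \<subseteq> Bad \<union> ?A"
  proof
    assume "G \<subseteq> Bad \<union> ?A"
    moreover have "finite (Bad \<union> ?A)" using finite_G finite_Stab fB unfolding Bad_def by auto
    ultimately have "card G \<le> card (Bad \<union> ?A)" by (intro card_mono)
    also have "\<dots> \<le> card Bad + card ?A" by (rule card_Un_le)
    finally have "n * h \<le> (h - 1) * (n - 1) + h" using cBad cA card_G by simp
    \<comment> \<open>The inequality amounts to \<open>n \<le> 1\<close>; the substitution removes
      truncated subtraction.\<close>
    moreover obtain m k where "n = m + 2" "h = k + 3" using n_ge_2 h3 by (metis le_add_diff_inverse2)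
    ultimately show False by (simp add: algebra_simps)
  qed
  then obtain b where b: "b \<in> G" "b \<notin> Bad" "b \<notin> ?A" by auto
  have bB: "perms_intersect n b s" if "s \<in> B" for s using b that unfolding Bad_def by auto
  let ?S = "insert b B"
  have "perms_intersect n s t" if "s \<in> ?S" "t \<in> ?S" for s t
  proof -
    have sym: "perms_intersect n s b" if "s \<in> B" for s
      using bB[OF that] intersect_iff[of b s] intersect_iff[of s b] b(1) that BG by (metis subsetD)
    have "s \<in> G" "t \<in> G" using that b BG by auto
    moreover have "perms_intersect n b b" using intersect_iff[OF b(1) b(1)] 1 by auto
    moreover have "perms_intersect n s t" if "s \<in> B" "t \<in> B"
    proof -
      have "s 1 = t 1" using that unfolding B_def point_stabilizer_def by simp
      then show ?thesis using that BG intersect_iff[of s t] 1 by blast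
    qed
    ultimately show ?thesis using that bB sym by auto
  qed
  then have int: "intersecting n ?S" unfolding intersecting_def by blast
  have "b \<notin> B" using b(3) unfolding B_def by simp
  then have "card ?S = h" using cB fB h3 by simp
  then obtain y g where y: "y \<in> \<Omega>" "g \<in> G" "?S = g <#\<^bsub>sym_group n\<^esub> Stab y"
    using assms int b(1) BG unfolding strict_EKR_def by (metis insert_subset)
  have coset: "s y = g y" if "s \<in> ?S" for s
    using that unfolding y(3) l_coset_def sym_group_mult point_stabilizer_def by auto
  have "card B \<ge> 2" using cB h3 by simp
  then obtain s t where st: "s \<in> B" "t \<in> B" "s \<noteq> t" by (metis card_le_Suc0_iff_eq fB not_less_eq_eq numeral_2_eq_2)
  have G: "s \<in> G" "t \<in> G" using st BG by auto
  have s1: "s 1 = 1" "t 1 = 1" using st unfolding B_def point_stabilizer_def by auto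
  \<comment> \<open>In a coset of \<open>Stab y\<close> the distinct \<open>s\<close>,
    \<open>t\<close> agree at \<open>y\<close>, and as members of \<open>B\<close> they agree at 1;
    distinct elements cannot agree at two points. That \<open>B\<close> has two elements is where
    \<open>h \<ge> 3\<close> enters.\<close>
  have "y = 1"
  proof (rule ccontr)
    assume "y \<noteq> 1"
    moreover have "(inv' s \<circ> t) y = y"
      using coset[of s] coset[of t] st inverse_simps(1)[OF G(1), of y] by simp
    moreover have "(inv' s \<circ> t) 1 = 1" using s1 inverse_simps(1)[OF G(1), of 1] by simp
    ultimately have "inv' s \<circ> t = id"
      using two_fixed_points[of "inv' s \<circ> t" y 1] y(1) 1 G comp_closed inv_closed by simp
    then have "s \<circ> (inv' s \<circ> t) = s" by simp
    then show False using st(3) G by (simp add: comp_assoc[symmetric])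
  qed
  then have "b 1 = 1" using coset[of b] coset[of s] st s1 by auto
  then show False using b unfolding point_stabilizer_def by simp
qed

text \<open>\<open>conj_subgroup\<close> conjugates with the inverse on the left and malnormality
  with the inverse on the right, so the hypothesis is applied to \<open>inv' g\<close>.\<close>

lemma malnormal_complement:
  assumes "frobenius_complement n G H"
  shows "malnormal PG H" "H \<noteq> {id}" "H \<noteq> G"
proof -
  have H: "subgroup H (sym_group n)" "H \<subseteq> G" "\<And>g. g \<in> G - H \<Longrightarrow> H \<inter> conj_subgroup n g H = {id}"
    and "H \<noteq> {id}" "H \<noteq> G"
    using assms unfolding frobenius_complement_def by auto
  then show "H \<noteq> {id}" "H \<noteq> G" by auto
  show "malnormal PG H"
  proof (rule malnormal_PG[OF H(1,2)])
    fix g l assume *: "g \<in> G" "l \<in> H" "l \<noteq> id" "g \<circ> l \<circ> inv' g \<in> H"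
    show "g \<in> H"
    proof (rule ccontr)
      assume "g \<notin> H"
      have inv_inv: "inv' (inv' g) = g" using permutes_inv_inv[OF permutes[OF *(1)]] .
      have "inv' g \<notin> H"
      proof
        assume a: "inv' g \<in> H"
        then have "inv\<^bsub>sym_group n\<^esub> (inv' g) \<in> H" by (rule subgroup.m_inv_closed[OF H(1)])
        then show False using \<open>g \<notin> H\<close> in_sym[OF inv_closed[OF *(1)]] inv_inv by simp
      qed
      then have "H \<inter> conj_subgroup n (inv' g) H = {id}" using H(3) *(1) inv_closed by simp
      moreover have "g \<circ> l \<circ> inv' g \<in> conj_subgroup n (inv' g) H"
        unfolding conj_subgroup_def using in_sym[OF inv_closed[OF *(1)]] inv_inv *(2)
        by (auto simp: sym_group_mult)
      ultimately have "g \<circ> l \<circ> inv' g = id" using *(4) by auto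
      then have "inv' g \<circ> (g \<circ> l \<circ> inv' g) \<circ> g = inv' g \<circ> id \<circ> g" by simp
      moreover have "inv' g \<circ> (g \<circ> l \<circ> inv' g) \<circ> g = l" using *(1) by (auto simp: fun_eq_iff)
      ultimately show False using *(1,3) by simp
    qed
  qed
qed

end

theorem theorem12:
  fixes n :: nat and G H :: "(nat \<Rightarrow> nat) set"
  assumes "frobenius_group n G"
    and "frobenius_complement n G H"
  shows "EKR n G \<and> (strict_EKR n G \<longleftrightarrow> card H = 2)"
proof -
  interpret frobenius_perm_group n G by unfold_locales (rule assms(1))
  have 1: "1 \<in> \<Omega>" using n_ge_2 by simp
  note S = malnormal_Stab[OF 1] and H = malnormal_complement[OF assms(2)]
  have c: "card (Stab 1) = h" by (rule card_Stab_eq[OF 1])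
  have "Stab 1 \<noteq> {id}" using c h_ge_2 by auto
  moreover have "Stab 1 \<noteq> G"
  proof
    assume "Stab 1 = G"
    then have "n * h = h" using c card_G by simp
    then show False using n_ge_2 h_ge_2 by simp
  qed
  \<comment> \<open>\<open>malnormal_card_two\<close> is symmetric in its two subgroups up to
    properness and nontriviality, so the stabilizer and \<open>H\<close> exchange roles for the two
    implications.\<close>
  ultimately have "h = 2 \<longleftrightarrow> card H = 2"
    using malnormal_card_two[OF S _ H(1)] malnormal_card_two[OF H(1) _ S] c H(2,3) one_PG by auto
  then show ?thesis using EKR strict_EKR_if_two two_if_strict_EKR by blast
qed

end
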